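(* Let $\mathbf{k}$ be an algebraically closed field of characteristic zero. The primary degenerations between $2$-dimensional terminal algebras over $\mathbf{k}$ (up to isomorphism) are exactly the following: - $\mathfrak{T}_{09}\to\mathfrak{T}_{07}(0)$ and $\mathfrak{T}_{09}\to\mathfrak{T}_{08}(1)$; - $\mathfrak{T}_{01}\to\mathfrak{T}_{03}$, $\mathfrak{T}_{02}\to\mathfrak{T}_{03}$, $\mathfrak{T}_{04}\to\mathfrak{T}_{03}$, $\mathfrak{T}_{05}\to\mathfrak{T}_{03}$; - $\mathfrak{T}_{07}(\alpha)\to\mathfrak{T}_{03}$ for every $\alpha\in\mathbf{k}\setminus\{1\}$; - $\mathfrak{T}_{08}(\alpha)\to\mathfrak{T}_{03}$ for every $\alpha\in\mathbf{k}\setminus\{2,\frac32\}$; - $\mathfrak{T}_{01}\to\mathfrak{T}_{10}(1)$ and $\mathfrak{T}_{02}\to\mathfrak{T}_{10}(2)$; - $\mathfrak{T}_{10}(\alpha)\to\mathbf{k}^2$ for every $\alpha\in\mathbf{k}$; - $\mathfrak{T}_{03}\to\mathbf{k}^2$ and $\mathfrak{T}_{06}\to\mathbf{k}^2$.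
   Context: An algebra $(\mathbb{V},\mathcal{P})$ is a vector space with a bilinear multiplication $\mathcal{P}$. For a bilinear map $\mathcal{A}$ and $a\in\mathbb V$ put $[\mathcal A,a](x)=\mathcal{A}(a,x)$. For a linear map $\mathcal{A}$ and a bilinear map $\mathcal{B}$ put $[\mathcal{A},\mathcal{B}](x,y)=\mathcal{A}(\mathcal{B}(x,y))-\mathcal{B}(\mathcal{A}(x),y)-\mathcal{B}(x,\mathcal{A}(y))$. For bilinear maps $\mathcal{A},\mathcal{B}$ put $$[\mathcal A,\mathcal B](x,y,z)=\mathcal A(\mathcal B(x,y),z)+\mathcal A(x,\mathcal B(y,z))+\mathcal A(y,\mathcal B(x,z))-\mathcal B(\mathcal A(x,y),z)-\mathcal B(x,\mathcal A(y,z))-\mathcal B(y,\mathcal A(x,z)).$$ $(\mathbb V,\mathcal P)$ is terminal if $[[[\mathcal{P},a],\mathcal{P}],\mathcal{P}]=0$ for every $a\in\mathbb V$. Let $\mathbb V=\mathbf{k}^2$ as a vector space. $\mathcal{A}_2=\mathrm{Hom}(\mathbb V\otimes\mathbb V,\mathbb V)\cong\mathbf{k}^8$ carries the Zariski topology; $GL(\mathbb V)$ acts by $(g*\mu)(x\otimes y)=g\mu(g^{-1}x\otimes g^{-1}y)$, and $O(\mu)$ is the orbit of $\mu$. $\mathfrak{T}_2\subset\mathcal{A}_2$ is the Zariski closed set of all terminal multiplications. If $\mathbf A,\mathbf B$ are represented by $\mu,\lambda\in\mathfrak{T}_2$, then $\mathbf A\to\mathbf B$ ($\mathbf A$ degenerates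 to $\mathbf B$) means $\lambda\in\overline{O(\mu)}$. A degeneration $\mathbf A\to\mathbf B$ is proper if $\mathbf A\not\cong\mathbf B$; a proper degeneration $\mathbf A\to\mathbf B$ is primary if there is no algebra $\mathbf C$ with $\mathbf C\not\cong\mathbf A,\mathbf B$, $\mathbf A\to\mathbf C$ and $\mathbf C\to\mathbf B$. The $2$-dimensional terminal algebras up to isomorphism are denoted as follows (basis $e_1,e_2$; unlisted products are zero); $\mathbf{k}^2$ denotes the algebra with zero multiplication. $\mathfrak{T}_{01}$: $e_1e_1=e_1+e_2$, $e_1e_2=e_2$. $\mathfrak{T}_{02}$: $e_1e_1=e_1+e_2$, $e_1e_2=2e_2$, $e_2e_1=-e_2$. $\mathfrak{T}_{03}$: $e_1e_1=e_2$. $\mathfrak{T}_{04}$: $e_2e_1=e_1$. $\mathfrak{T}_{05}$: $e_1e_2=2e_1$, $e_2e_1=-e_1$. $\mathfrak{T}_{06}$: $e_1e_2=e_2$, $e_2e_1=-e_2$. $\mathfrak{T}_{07}(\alpha)$, $\alpha\in\mathbf{k}\setminus\{1\}$: $e_1e_1=e_1$, $e_1e_2=\alpha e_2$. $\mathfrak{T}_{08}(\alpha)$, $\alpha\in\mathbf{k}\setminus\{2,\frac32\}$: $e_1e_1=e_1$, $e_1e_2=\alpha e_2$, $e_2e_1=(3-2\alpha)e_2$. $\mathfrak{T}_{09}$: $e_1e_1=e_1$, $e_2e_2=e_2$. $\mathfrak{T}_{10}(\alpha)$, $\alpha\in\mathbf{k}$: $e_1e_1=e_1$, $e_1e_2=(1-\alpha)e_1+\alpha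 e_2$, $e_2e_1=\alpha e_1+(1-\alpha)e_2$, $e_2e_2=e_2$. *)

theory Defs
  imports "HOL-Analysis.Analysis" "HOL-Computational_Algebra.Polynomial"
begin

definition bracket_bil_elem :: "('v \<Rightarrow> 'v \<Rightarrow> 'v) \<Rightarrow> 'v \<Rightarrow> 'v \<Rightarrow> 'v"
  where "bracket_bil_elem A a = (\<lambda>x. A a x)"

definition bracket_lin_bil ::
    "('v \<Rightarrow> 'v) \<Rightarrow> ('v \<Rightarrow> 'v \<Rightarrow> 'v) \<Rightarrow> 'v \<Rightarrow> 'v \<Rightarrow> 'v::ab_group_add"
  where "bracket_lin_bil A B = (\<lambda>x y. A (B x y) - B (A x) y - B x (A y))"

definition bracket_bil_bil ::
    "('v \<Rightarrow> 'v \<Rightarrow> 'v) \<Rightarrow> ('v \<Rightarrow> 'v \<Rightarrow> 'v) \<Rightarrow> 'v \<Rightarrow> 'v \<Rightarrow> 'v \<Rightarrow> 'v::ab_group_add"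
  where "bracket_bil_bil A B = (\<lambda>x y z.
      A (B x y) z + A x (B y z) + A y (B x z)
    - B (A x y) z - B x (A y z) - B y (A x z))"

type_synonym 'k mult2 = "'k^2 \<Rightarrow> 'k^2 \<Rightarrow> 'k^2"

text \<open>The space \<open>Hom(V \<otimes> V, V)\<close> for \<open>V = k\<^sup>2\<close>, as the set of bilinear maps. The library
  constant \<^const>\<open>bilinear\<close> is restricted to real vector spaces.\<close>

definition mults2 :: "'k::field mult2 set"
  where "mults2 = {\<mu>. (\<forall>x. Vector_Spaces.linear (*s) (*s) (\<mu> x)) \<and>
                      (\<forall>y. Vector_Spaces.linear (*s) (*s) (\<lambda>x. \<mu> x y))}"

definition terminal2 :: "'k::field mult2 set"
  where "terminal2 = {\<mu> \<in> mults2. \<forall>a x y z.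
     bracket_bil_bil (bracket_lin_bil (bracket_bil_elem \<mu> a) \<mu>) \<mu> x y z = 0}"

text \<open>Polynomial functions on \<open>k\<^sup>8\<close>, whose coordinates are the structure constants.\<close>

inductive_set polyfun_mults2 :: "('k::field mult2 \<Rightarrow> 'k) set" where
  coord: "(\<lambda>\<mu>. \<mu> (axis i 1) (axis j 1) $ l) \<in> polyfun_mults2"
| const: "(\<lambda>\<mu>. c) \<in> polyfun_mults2"
| add: "f \<in> polyfun_mults2 \<Longrightarrow> g \<in> polyfun_mults2 \<Longrightarrow> (\<lambda>\<mu>. f \<mu> + g \<mu>) \<in> polyfun_mults2"
| mult: "f \<in> polyfun_mults2 \<Longrightarrow> g \<in> polyfun_mults2 \<Longrightarrow> (\<lambda>\<mu>. f \<mu> * g \<mu>) \<in> polyfun_mults2"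

definition zero_locus :: "('k::field mult2 \<Rightarrow> 'k) set \<Rightarrow> 'k mult2 set"
  where "zero_locus F = {\<mu> \<in> mults2. \<forall>f\<in>F. f \<mu> = 0}"

definition zariski_mults2 :: "'k::field mult2 topology"
  where "zariski_mults2 = topology (\<lambda>U. \<exists>F \<subseteq> polyfun_mults2. U = mults2 - zero_locus F)"

lemma istopology_zariski:
  "istopology (\<lambda>U :: 'k::field mult2 set. \<exists>F \<subseteq> polyfun_mults2. U = mults2 - zero_locus F)"
  unfolding istopology_def
proof (intro conjI allI impI)
  fix U V :: "'k mult2 set"
  assume "\<exists>F \<subseteq> polyfun_mults2. U = mults2 - zero_locus F"
     and "\<exists>F \<subseteq> polyfun_mults2. V = mults2 - zero_locus F"
  then obtain F G where F: "F \<subseteq> polyfun_mults2" "U = mults2 - zero_locus F"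
    and G: "G \<subseteq> polyfun_mults2" "V = mults2 - zero_locus G" by blast
  define H where "H = (\<Union>f\<in>F. (\<lambda>g \<mu>. f \<mu> * g \<mu>) ` G)"
  have "H \<subseteq> polyfun_mults2"
    unfolding H_def using F(1) G(1) by (blast intro: polyfun_mults2.mult)
  moreover have "U \<inter> V = mults2 - zero_locus H"
  proof -
    have "\<mu> \<in> zero_locus H \<longleftrightarrow> \<mu> \<in> zero_locus F \<or> \<mu> \<in> zero_locus G" for \<mu>
    proof -
      have "(\<forall>h\<in>H. h \<mu> = 0) \<longleftrightarrow> (\<forall>f\<in>F. \<forall>g\<in>G. f \<mu> * g \<mu> = 0)"
        by (simp add: H_def)
      then show ?thesis unfolding zero_locus_def by auto
    qed
    then show ?thesis unfolding F(2) G(2) by blast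
  qed
  ultimately show "\<exists>F \<subseteq> polyfun_mults2. U \<inter> V = mults2 - zero_locus F" by blast
next
  fix K :: "'k mult2 set set"
  assume "\<forall>U\<in>K. \<exists>F \<subseteq> polyfun_mults2. U = mults2 - zero_locus F"
  then have "\<forall>U\<in>K. \<exists>F. F \<subseteq> polyfun_mults2 \<and> U = mults2 - zero_locus F" by simp
  then have "\<exists>\<F>. \<forall>U\<in>K. \<F> U \<subseteq> polyfun_mults2 \<and> U = mults2 - zero_locus (\<F> U)"
    by (rule bchoice)
  then obtain \<F> where "\<forall>U\<in>K. \<F> U \<subseteq> polyfun_mults2 \<and> U = mults2 - zero_locus (\<F> U)" ..
  note \<F>_all = this
  have \<F>: "\<F> U \<subseteq> polyfun_mults2" "U = mults2 - zero_locus (\<F> U)" if "U \<in> K" for U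
    using bspec[OF \<F>_all that] by (rule conjunct1, rule conjunct2)
  have "\<Union>K = (\<Union>U\<in>K. U)" by simp
  also have "\<dots> = (\<Union>U\<in>K. mults2 - zero_locus (\<F> U))"
    by (rule SUP_cong[OF refl \<F>(2)])
  also have "\<dots> = mults2 - zero_locus (\<Union>U\<in>K. \<F> U)"
    by (auto simp: zero_locus_def)
  finally have "\<Union>K = mults2 - zero_locus (\<Union>U\<in>K. \<F> U)" .
  moreover have "(\<Union>U\<in>K. \<F> U) \<subseteq> polyfun_mults2"
    using \<F>(1) by (rule UN_least)
  ultimately show "\<exists>F \<subseteq> polyfun_mults2. \<Union>K = mults2 - zero_locus F" by blast
qed

lemma openin_zariski:
  "openin zariski_mults2 U \<longleftrightarrow> (\<exists>F \<subseteq> polyfun_mults2. U = mults2 - zero_locus F)"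
  unfolding zariski_mults2_def topology_inverse'[OF istopology_zariski] ..

lemma topspace_zariski: "topspace (zariski_mults2 :: 'k::field mult2 topology) = mults2"
proof
  show "topspace (zariski_mults2 :: 'k mult2 topology) \<subseteq> mults2"
    using openin_topspace[of "zariski_mults2 :: 'k mult2 topology"]
    unfolding openin_zariski by (elim exE conjE) (simp only: Diff_subset)
  have "(mults2 :: 'k mult2 set) = mults2 - zero_locus {\<lambda>\<mu>. 1}"
    by (auto simp: zero_locus_def)
  then have "openin (zariski_mults2 :: 'k mult2 topology) mults2"
    unfolding openin_zariski
    by (intro exI[of _ "{\<lambda>\<mu>. 1}"]) (simp add: polyfun_mults2.const)
  then show "mults2 \<subseteq> topspace (zariski_mults2 :: 'k mult2 topology)" by (rule openin_subset)
qed

lemma closedin_zariski: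
  fixes S :: "'k::field mult2 set"
  shows "closedin zariski_mults2 S \<longleftrightarrow> (\<exists>F \<subseteq> polyfun_mults2. S = zero_locus F)"
proof -
  have sub: "zero_locus F \<subseteq> mults2" for F :: "('k mult2 \<Rightarrow> 'k) set"
    unfolding zero_locus_def by blast
  have "closedin zariski_mults2 S \<longleftrightarrow>
      S \<subseteq> mults2 \<and> (\<exists>F \<subseteq> polyfun_mults2. mults2 - S = mults2 - zero_locus F)"
    unfolding closedin_def topspace_zariski openin_zariski ..
  also have "\<dots> \<longleftrightarrow> (\<exists>F \<subseteq> polyfun_mults2. S = zero_locus F)"
  proof -
    have "S \<subseteq> mults2 \<and> mults2 - S = mults2 - zero_locus F \<longleftrightarrow> S = zero_locus F"
      for F :: "('k mult2 \<Rightarrow> 'k) set"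
      using sub[of F] by blast
    then show ?thesis by blast
  qed
  finally show ?thesis .
qed

definition GL2 :: "('k::field^2 \<Rightarrow> 'k^2) set"
  where "GL2 = {g. Vector_Spaces.linear (*s) (*s) g \<and> bij g}"

definition act :: "('k::field^2 \<Rightarrow> 'k^2) \<Rightarrow> 'k mult2 \<Rightarrow> 'k mult2"
  where "act g \<mu> = (\<lambda>x y. g (\<mu> (inv g x) (inv g y)))"

definition orbit :: "'k::field mult2 \<Rightarrow> 'k mult2 set"
  where "orbit \<mu> = {act g \<mu> | g. g \<in> GL2}"

definition alg_iso :: "'k::field mult2 \<Rightarrow> 'k mult2 \<Rightarrow> bool"  (infix \<open>\<cong>\<^sub>a\<close> 50)
  where "\<mu> \<cong>\<^sub>a \<nu> \<longleftrightarrow> (\<exists>g\<in>GL2. \<forall>x y. g (\<mu> x y) = \<nu> (g x) (g y))"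

definition degenerates :: "'k::field mult2 \<Rightarrow> 'k mult2 \<Rightarrow> bool"
  where "degenerates \<mu> \<nu> \<longleftrightarrow>
    \<mu> \<in> terminal2 \<and> \<nu> \<in> terminal2 \<and> \<nu> \<in> zariski_mults2 closure_of orbit \<mu>"

definition proper_degeneration :: "'k::field mult2 \<Rightarrow> 'k mult2 \<Rightarrow> bool"
  where "proper_degeneration \<mu> \<nu> \<longleftrightarrow> degenerates \<mu> \<nu> \<and> \<not> \<mu> \<cong>\<^sub>a \<nu>"

definition primary_degeneration :: "'k::field mult2 \<Rightarrow> 'k mult2 \<Rightarrow> bool"
  where "primary_degeneration \<mu> \<nu> \<longleftrightarrow> proper_degeneration \<mu> \<nu> \<and>
    (\<nexists>\<rho>. \<not> \<rho> \<cong>\<^sub>a \<mu> \<and> \<not> \<rho> \<cong>\<^sub>a \<nu> \<and> degenerates \<mu> \<rho> \<and> degenerates \<rho> \<nu>)"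

abbreviation e1 :: "'k::field^2" where "e1 \<equiv> axis 1 1"
abbreviation e2 :: "'k::field^2" where "e2 \<equiv> axis 2 1"

definition mult_table :: "'k::field^2 \<Rightarrow> 'k^2 \<Rightarrow> 'k^2 \<Rightarrow> 'k^2 \<Rightarrow> 'k mult2"
  where "mult_table a b c d = (\<lambda>x y.
    (x$1 * y$1) *s a + (x$1 * y$2) *s b + (x$2 * y$1) *s c + (x$2 * y$2) *s d)"

definition T01 :: "'k::field mult2" where "T01 = mult_table (e1 + e2) e2 0 0"
definition T02 :: "'k::field mult2" where "T02 = mult_table (e1 + e2) (2 *s e2) (- e2) 0"
definition T03 :: "'k::field mult2" where "T03 = mult_table e2 0 0 0"
definition T04 :: "'k::field mult2" where "T04 = mult_table 0 0 e1 0"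
definition T05 :: "'k::field mult2" where "T05 = mult_table 0 (2 *s e1) (- e1) 0"
definition T06 :: "'k::field mult2" where "T06 = mult_table 0 e2 (- e2) 0"
definition T07 :: "'k::field \<Rightarrow> 'k mult2" where "T07 \<alpha> = mult_table e1 (\<alpha> *s e2) 0 0"
definition T08 :: "'k::field \<Rightarrow> 'k mult2"
  where "T08 \<alpha> = mult_table e1 (\<alpha> *s e2) ((3 - 2 * \<alpha>) *s e2) 0"
definition T09 :: "'k::field mult2" where "T09 = mult_table e1 0 0 e2"
definition T10 :: "'k::field \<Rightarrow> 'k mult2"
  where "T10 \<alpha> = mult_table e1 ((1 - \<alpha>) *s e1 + \<alpha> *s e2) (\<alpha> *s e1 + (1 - \<alpha>) *s e2) e2"
definition zero_alg :: "'k::field mult2" where "zero_alg = mult_table 0 0 0 0"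

lemma mult_table_basis [simp]:
  "mult_table a b c d e1 e1 = a" "mult_table a b c d e1 e2 = b"
  "mult_table a b c d e2 e1 = c" "mult_table a b c d e2 e2 = d"
  by (simp_all add: mult_table_def axis_def)

end

theory Submission
  imports Defs
begin

text \<open>Over an algebraically closed field the binary cubic \<open>x \<and> xx\<close> has a nontrivial zero, so some \<open>x \<noteq> 0\<close>
  satisfies \<open>xx = x\<close> or \<open>xx = 0\<close>. In a basis starting with \<open>x\<close> the terminal identity factorises, and
  substitutions \<open>e\<^sub>2 \<mapsto> e\<^sub>2 + s e\<^sub>1\<close> lead to the normal forms.

  A degeneration is produced by a family of bases depending on \<open>t\<close> whose structure constants are polynomial
  in \<open>t\<close>; in particular any algebra with \<open>x\<close> and \<open>xx\<close> independent degenerates to \<open>T\<^sub>0\<^sub>3\<close>, through the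
  basis \<open>t x, t\<^sup>2 xx\<close>. Degenerations are excluded by closed invariant conditions: the ratio of the
  traces of \<open>L\<^sub>x\<close> and \<open>R\<^sub>x\<close> separates the members of each of the families \<open>T\<^sub>0\<^sub>7\<close>, \<open>T\<^sub>0\<^sub>8\<close>, \<open>T\<^sub>1\<^sub>0\<close>, while the
  rank of \<open>x \<mapsto> L\<^sub>x\<close>, the discriminant of \<open>2 L\<^sub>x + R\<^sub>x\<close>, and the vanishing of \<open>x \<and> xx\<close> separate
  the families from one another.\<close>

section \<open>Isomorphisms and bases\<close>

text \<open>Let \<open>b\<close> and \<open>d\<close> be the scalars by which left and right
  multiplication by the eigenvector x act modulo the line of x. If xx = x, the terminal identity
  forces d = 0, 2b + d = 3 or b + d = 1; if xx = 0, it forces the homogeneous analogues. These three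
  branches are the origin of the invariants. The first leads to \<open>T07\<close>, where all left
  multiplications are proportional, as they are in \<open>T01\<close> and \<open>T04\<close>. In the
  second, 2 L_x + R_x has the double eigenvalue 3; it leads to \<open>T08\<close>, accompanied by
  \<open>T02\<close> and \<open>T05\<close>. The third leads to \<open>T10\<close>, where every line
  is a subalgebra, as in \<open>T06\<close>.

  An invariant confines degenerations to its branch, and the trace ratio then fixes the parameter.
  The excluded parameters are the places where branches meet: \<open>T07 1\<close> is isomorphic to
  \<open>T10 1\<close>, \<open>T08 2\<close> to \<open>T10 2\<close>, and \<open>T08 (3/2)\<close>
  is \<open>T07 (3/2)\<close>.

  The algebra \<open>T09\<close> appears in the first two branches, so only its trace ratio 1 : 1
  restricts its limits. That admits \<open>T10 (1/2)\<close>, which is commutative as well;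
  associativity is the additional closed condition that excludes it.\<close>

definition wedge :: "'k::field^2 \<Rightarrow> 'k^2 \<Rightarrow> 'k"
  where "wedge x y = x$1 * y$2 - x$2 * y$1"

lemma vec2_eq_iff: "x = y \<longleftrightarrow> x$1 = y$1 \<and> x$2 = (y$2 :: 'a)" for x y :: "'a^2"
  by (simp add: vec_eq_iff forall_2)

lemma axis_nth2 [simp]:
  "(axis 1 1 :: 'a::zero_neq_one^2)$1 = 1" "(axis 1 1 :: 'a^2)$2 = 0"
  "(axis 2 1 :: 'a^2)$1 = 0" "(axis 2 1 :: 'a^2)$2 = 1"
  by (simp_all add: axis_def)

lemma linear_vec2_iff:
  "Vector_Spaces.linear (*s) (*s) f \<longleftrightarrow>
    (\<forall>x y. f (x + y) = f x + f y) \<and> (\<forall>c x. f (c *s x) = c *s f x)"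
  for f :: "'k::field^2 \<Rightarrow> 'k^2"
  by (simp add: Vector_Spaces.linear_iff vec.vector_space_axioms)

lemma linear_vec2_expand:
  fixes f :: "'k::field^2 \<Rightarrow> 'k^2"
  assumes "Vector_Spaces.linear (*s) (*s) f"
  shows "f x = x$1 *s f e1 + x$2 *s f e2"
proof -
  have "x = x$1 *s e1 + x$2 *s e2" by (simp add: vec2_eq_iff)
  then show ?thesis using assms unfolding linear_vec2_iff by metis
qed

lemma linear_wedge:
  assumes "Vector_Spaces.linear (*s) (*s) g"
  shows "wedge (g x) (g y) = wedge (g e1) (g e2) * wedge x y"
  by (subst (1 2) linear_vec2_expand[OF assms]) (simp add: wedge_def algebra_simps)

text \<open>Cramer's rule: \<open>wedge\<close> is the determinant of two vectors, and its
  nonvanishing says that they form a basis.\<close>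

lemma wedge_ne_0_coords:
  assumes "wedge u v \<noteq> 0"
  shows "x = (wedge x v / wedge u v) *s u + (wedge u x / wedge u v) *s v"
  using assms unfolding vec2_eq_iff
  by (simp add: divide_simps) (simp add: wedge_def algebra_simps)

lemma GL2_of_basis:
  fixes u v :: "'k::field^2"
  assumes "wedge u v \<noteq> 0"
  shows "(\<lambda>x. x$1 *s u + x$2 *s v) \<in> GL2"
proof -
  let ?g = "\<lambda>x::'k^2. x$1 *s u + x$2 *s v"
  have lin: "Vector_Spaces.linear (*s) (*s) ?g"
    by (simp add: linear_vec2_iff vec2_eq_iff algebra_simps)
  have "x = y" if "?g x = ?g y" for x y
  proof -
    have "x$1 * wedge u v = wedge (?g x) v" "x$2 * wedge u v = wedge u (?g x)"
      "y$1 * wedge u v = wedge (?g y) v" "y$2 * wedge u v = wedge u (?g y)"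
      by (simp_all add: wedge_def algebra_simps)
    then have "x$1 * wedge u v = y$1 * wedge u v" "x$2 * wedge u v = y$2 * wedge u v"
      by (simp_all only: that)
    then show ?thesis using assms by (simp add: vec2_eq_iff)
  qed
  moreover have "\<exists>z. x = ?g z" for x
    using wedge_ne_0_coords[OF assms, of x]
    by (intro exI[of _ "(wedge x v / wedge u v) *s e1 + (wedge u x / wedge u v) *s e2"]) simp
  ultimately have "bij ?g" unfolding bij_def inj_def surj_def by blast
  then show ?thesis using lin by (simp add: GL2_def)
qed

lemma GL2_wedge:
  assumes "g \<in> GL2"
  obtains D where "D \<noteq> 0" "\<And>x y. wedge (g x) (g y) = D * wedge x y"
proof
  have lin: "Vector_Spaces.linear (*s) (*s) g" and "bij g" using assms by (auto simp: GL2_def)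
  show w: "wedge (g x) (g y) = wedge (g e1) (g e2) * wedge x y" for x y
    by (rule linear_wedge[OF lin])
  \<comment> \<open>Preimages of the standard basis exhibit an inverse of the determinant of
    \<open>g\<close>.\<close>
  obtain x y where "g x = e1" "g y = e2" using \<open>bij g\<close> by (metis bij_pointE)
  then have "wedge (g e1) (g e2) * wedge x y = 1" using w[of x y] by (simp add: wedge_def)
  then show "wedge (g e1) (g e2) \<noteq> 0" by auto
qed

lemma id_GL2: "id \<in> GL2"
  by (simp add: GL2_def linear_vec2_iff)

lemma inv_GL2:
  assumes "g \<in> GL2" shows "inv g \<in> GL2"
proof -
  have g: "\<And>x y. g (x + y) = g x + g y" "\<And>c x. g (c *s x) = c *s g x" "bij g"
    using assms by (auto simp: GL2_def linear_vec2_iff)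
  note s = surj_f_inv_f[OF bij_is_surj[OF g(3)]] inv_f_f[OF bij_is_inj[OF g(3)]]
  have "inv g (x + y) = inv g x + inv g y" for x y by (metis s g(1))
  moreover have "inv g (c *s x) = c *s inv g x" for c x by (metis s g(2))
  ultimately show ?thesis using g(3) by (simp add: GL2_def linear_vec2_iff bij_imp_bij_inv)
qed

lemma comp_GL2: "g \<in> GL2 \<Longrightarrow> h \<in> GL2 \<Longrightarrow> g \<circ> h \<in> GL2"
  by (simp add: GL2_def linear_vec2_iff bij_comp)

lemma alg_iso_refl: "\<mu> \<cong>\<^sub>a \<mu>"
  unfolding alg_iso_def by (rule bexI[OF _ id_GL2]) simp

lemma alg_iso_iff_act: "\<mu> \<cong>\<^sub>a \<nu> \<longleftrightarrow> (\<exists>g\<in>GL2. \<nu> = act g \<mu>)"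
proof -
  have "(\<forall>x y. g (\<mu> x y) = \<nu> (g x) (g y)) \<longleftrightarrow> \<nu> = act g \<mu>" if "g \<in> GL2" for g
  proof -
    have "bij g" using that by (simp add: GL2_def)
    then have "g (inv g x) = x" "inv g (g x) = x" for x
      by (simp_all add: bij_is_surj bij_is_inj surj_f_inv_f)
    then show ?thesis unfolding act_def fun_eq_iff by metis
  qed
  then show ?thesis unfolding alg_iso_def by blast
qed

lemma orbit_eq: "orbit \<mu> = {\<nu>. \<mu> \<cong>\<^sub>a \<nu>}"
  unfolding orbit_def alg_iso_iff_act by blast

lemma alg_iso_sym:
  assumes "\<mu> \<cong>\<^sub>a \<nu>" shows "\<nu> \<cong>\<^sub>a \<mu>"
proof -
  obtain g where g: "g \<in> GL2" "\<And>x y. g (\<mu> x y) = \<nu> (g x) (g y)"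
    using assms by (auto simp: alg_iso_def)
  then have "bij g" by (simp add: GL2_def)
  then have "inv g (\<nu> x y) = \<mu> (inv g x) (inv g y)" for x y
  proof -
    have "\<nu> x y = \<nu> (g (inv g x)) (g (inv g y))"
      using \<open>bij g\<close> by (simp add: bij_is_surj surj_f_inv_f)
    also have "\<dots> = g (\<mu> (inv g x) (inv g y))" by (simp add: g(2))
    finally show ?thesis using \<open>bij g\<close> by (simp add: bij_is_inj)
  qed
  then show ?thesis unfolding alg_iso_def using inv_GL2[OF g(1)] by blast
qed

lemma alg_iso_trans:
  assumes "\<mu> \<cong>\<^sub>a \<nu>" "\<nu> \<cong>\<^sub>a \<rho>" shows "\<mu> \<cong>\<^sub>a \<rho>"
proof -
  obtain g h where "g \<in> GL2" "\<And>x y. g (\<mu> x y) = \<nu> (g x) (g y)"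
    "h \<in> GL2" "\<And>x y. h (\<nu> x y) = \<rho> (h x) (h y)"
    using assms by (auto simp: alg_iso_def)
  then show ?thesis unfolding alg_iso_def
    by (intro bexI[of _ "h \<circ> g"]) (simp_all add: comp_GL2)
qed

section \<open>Bilinear multiplications and their structure constants\<close>

lemma mults2_iff:
  "\<mu> \<in> mults2 \<longleftrightarrow>
    (\<forall>x y z. \<mu> x (y + z) = \<mu> x y + \<mu> x z) \<and> (\<forall>x y z. \<mu> (x + y) z = \<mu> x z + \<mu> y z) \<and>
    (\<forall>c x y. \<mu> x (c *s y) = c *s \<mu> x y) \<and> (\<forall>c x y. \<mu> (c *s x) y = c *s \<mu> x y)"
  by (auto simp: mults2_def linear_vec2_iff)

lemma mult_table_mults2 [simp]: "mult_table a b c d \<in> mults2"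
  by (simp add: mults2_iff mult_table_def vec2_eq_iff algebra_simps)

lemma mults2_simps:
  assumes "\<mu> \<in> mults2"
  shows "\<mu> x (y + z) = \<mu> x y + \<mu> x z" "\<mu> (x + y) z = \<mu> x z + \<mu> y z"
    "\<mu> x (c *s y) = c *s \<mu> x y" "\<mu> (c *s x) y = c *s \<mu> x y"
  using assms by (auto simp: mults2_iff)

lemma mults2_alg_iso:
  assumes "\<mu> \<cong>\<^sub>a \<nu>" "\<mu> \<in> mults2" shows "\<nu> \<in> mults2"
proof -
  obtain g where g: "g \<in> GL2" and \<nu>: "\<nu> = act g \<mu>" using assms(1) by (auto simp: alg_iso_iff_act)
  have "Vector_Spaces.linear (*s) (*s) g" "Vector_Spaces.linear (*s) (*s) (inv g)"
    using g inv_GL2[OF g] by (auto simp: GL2_def)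
  then show ?thesis using assms(2) by (simp add: \<nu> act_def mults2_iff linear_vec2_iff)
qed

lemma mults2_expand:
  assumes "\<mu> \<in> mults2"
  shows "\<mu> = mult_table (\<mu> e1 e1) (\<mu> e1 e2) (\<mu> e2 e1) (\<mu> e2 e2)"
proof (intro ext)
  fix x y :: "'a^2"
  have l: "\<mu> x y = x$1 *s \<mu> e1 y + x$2 *s \<mu> e2 y"
    by (rule linear_vec2_expand) (use assms in \<open>simp add: mults2_def\<close>)
  have r: "\<mu> z y = y$1 *s \<mu> z e1 + y$2 *s \<mu> z e2" for z
    by (rule linear_vec2_expand) (use assms in \<open>simp add: mults2_def\<close>)
  show "\<mu> x y = mult_table (\<mu> e1 e1) (\<mu> e1 e2) (\<mu> e2 e1) (\<mu> e2 e2) x y"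
    unfolding l r[of e1] r[of e2] by (simp add: mult_table_def vec2_eq_iff algebra_simps)
qed

text \<open>The map sending coordinates to vectors in the basis \<open>u\<close>, \<open>v\<close>
  is a homomorphism from the table to \<open>\<mu>\<close>, hence the reversal by symmetry.\<close>

lemma alg_iso_tableI:
  assumes "\<mu> \<in> mults2" "wedge u v \<noteq> 0"
    "\<mu> u u = a$1 *s u + a$2 *s v" "\<mu> u v = b$1 *s u + b$2 *s v"
    "\<mu> v u = c$1 *s u + c$2 *s v" "\<mu> v v = d$1 *s u + d$2 *s v"
  shows "\<mu> \<cong>\<^sub>a mult_table a b c d"
proof (rule alg_iso_sym)
  let ?g = "\<lambda>x. x$1 *s u + x$2 *s v"
  have "?g (mult_table a b c d x y) = \<mu> (?g x) (?g y)" for x y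
    by (simp add: mult_table_def mults2_simps[OF assms(1)] assms(3-6) vec2_eq_iff algebra_simps)
  then show "mult_table a b c d \<cong>\<^sub>a \<mu>"
    unfolding alg_iso_def by (intro bexI[OF _ GL2_of_basis[OF assms(2)]] allI)
qed

text \<open>The brackets are built from the multiplication by sums, differences and composition, so
  they are natural under isomorphisms.\<close>

lemma bracket_alg_iso:
  fixes \<mu> \<nu> :: "'k::field mult2" and a x y z :: "'k^2"
  assumes g: "g \<in> GL2" and hom: "\<And>x y. g (\<mu> x y) = \<nu> (g x) (g y)"
  shows "bracket_bil_bil (bracket_lin_bil (bracket_bil_elem \<nu> (g a)) \<nu>) \<nu> (g x) (g y) (g z) =
    g (bracket_bil_bil (bracket_lin_bil (bracket_bil_elem \<mu> a) \<mu>) \<mu> x y z)"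
proof -
  have add: "\<And>x y. g (x + y) = g x + g y" and sc: "\<And>c x. g (c *s x) = c *s g x"
    using g by (auto simp: GL2_def linear_vec2_iff)
  have "g (- x) = - g x" for x using sc[of "-1" x] by simp
  then have diff: "\<And>x y. g (x - y) = g x - g y" using add by (metis diff_conv_add_uminus)
  show ?thesis
    by (simp add: bracket_bil_bil_def bracket_lin_bil_def bracket_bil_elem_def
        add diff hom)
qed

lemma terminal2_alg_iso:
  assumes "\<mu> \<cong>\<^sub>a \<nu>" "\<mu> \<in> terminal2" shows "\<nu> \<in> terminal2"
proof -
  obtain g where g: "g \<in> GL2" "\<And>x y. g (\<mu> x y) = \<nu> (g x) (g y)"
    using assms(1) by (auto simp: alg_iso_def)
  have m: "\<mu> \<in> mults2" using assms(2) by (simp add: terminal2_def)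
  have "bij g" and g0: "g 0 = 0"
    using g(1) vec.linear_0 by (auto simp: GL2_def)
  have zero: "bracket_bil_bil (bracket_lin_bil (bracket_bil_elem \<mu> a) \<mu>) \<mu> x y z = 0" for a x y z
    using assms(2) unfolding terminal2_def by blast
  have "bracket_bil_bil (bracket_lin_bil (bracket_bil_elem \<nu> a) \<nu>) \<nu> x y z = 0" for a x y z
  proof -
    obtain h where h: "\<And>x. x = g (h x)" using \<open>bij g\<close> by (metis bij_pointE)
    have "bracket_bil_bil (bracket_lin_bil (bracket_bil_elem \<nu> (g (h a))) \<nu>) \<nu>
        (g (h x)) (g (h y)) (g (h z)) = 0"
      unfolding bracket_alg_iso[where \<mu> = \<mu> and \<nu> = \<nu>, OF g] zero g0 ..
    then show ?thesis unfolding h[symmetric] .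
  qed
  then show ?thesis using mults2_alg_iso[OF assms(1) m] by (simp add: terminal2_def)
qed

section \<open>Orbit closures\<close>

text \<open>Members of \<^const>\<open>polyfun_mults2\<close> are polynomial on all of \<^typ>\<open>'k mult2\<close>, not only on the
  bilinear maps; expressions such as \<open>\<mu> x y $ i\<close> agree with one of them on \<^const>\<open>mults2\<close> only.\<close>

definition regular :: "('k::field mult2 \<Rightarrow> 'k) \<Rightarrow> bool"
  where "regular f \<longleftrightarrow> (\<exists>p\<in>polyfun_mults2. \<forall>\<mu>\<in>mults2. f \<mu> = p \<mu>)"

definition regular_vec :: "('k::field mult2 \<Rightarrow> 'k^2) \<Rightarrow> bool"
  where "regular_vec F \<longleftrightarrow> (\<forall>i. regular (\<lambda>\<mu>. F \<mu> $ i))"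

lemma regular_const: "regular (\<lambda>\<mu>. c)"
  unfolding regular_def by (intro bexI[of _ "\<lambda>\<mu>. c"] polyfun_mults2.const) simp

lemma regular_add:
  assumes "regular f" "regular g" shows "regular (\<lambda>\<mu>. f \<mu> + g \<mu>)"
proof -
  obtain p q where "p \<in> polyfun_mults2" "\<forall>\<mu>\<in>mults2. f \<mu> = p \<mu>"
    "q \<in> polyfun_mults2" "\<forall>\<mu>\<in>mults2. g \<mu> = q \<mu>"
    using assms by (auto simp: regular_def)
  then show ?thesis unfolding regular_def
    by (intro bexI[of _ "\<lambda>\<mu>. p \<mu> + q \<mu>"]) (simp_all add: polyfun_mults2.add)
qed

lemma regular_mult:
  assumes "regular f" "regular g" shows "regular (\<lambda>\<mu>. f \<mu> * g \<mu>)"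
proof -
  obtain p q where "p \<in> polyfun_mults2" "\<forall>\<mu>\<in>mults2. f \<mu> = p \<mu>"
    "q \<in> polyfun_mults2" "\<forall>\<mu>\<in>mults2. g \<mu> = q \<mu>"
    using assms by (auto simp: regular_def)
  then show ?thesis unfolding regular_def
    by (intro bexI[of _ "\<lambda>\<mu>. p \<mu> * q \<mu>"]) (simp_all add: polyfun_mults2.mult)
qed

lemma regular_diff:
  assumes "regular f" "regular g" shows "regular (\<lambda>\<mu>. f \<mu> - g \<mu>)"
  using regular_add[OF assms(1) regular_mult[OF regular_const[of "-1"] assms(2)]] by simp

lemma regular_power:
  assumes "regular f" shows "regular (\<lambda>\<mu>. f \<mu> ^ n)"
  by (induction n) (simp_all add: regular_const regular_mult[OF assms])

lemma regular_vec_const: "regular_vec (\<lambda>\<mu>. c)"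
  by (simp add: regular_vec_def regular_const)

lemma regular_vec_add:
  "regular_vec F \<Longrightarrow> regular_vec G \<Longrightarrow> regular_vec (\<lambda>\<mu>. F \<mu> + G \<mu>)"
  by (simp add: regular_vec_def regular_add)

lemma regular_vec_scale:
  "regular f \<Longrightarrow> regular_vec F \<Longrightarrow> regular_vec (\<lambda>\<mu>. f \<mu> *s F \<mu>)"
  by (simp add: regular_vec_def regular_mult)

lemma regular_wedge:
  "regular_vec F \<Longrightarrow> regular_vec G \<Longrightarrow> regular (\<lambda>\<mu>. wedge (F \<mu>) (G \<mu>))"
  by (simp add: regular_vec_def wedge_def regular_mult regular_diff)

lemma regular_vec_cong:
  assumes "\<And>\<mu>. \<mu> \<in> mults2 \<Longrightarrow> F \<mu> = G \<mu>" "regular_vec G" shows "regular_vec F"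
  using assms by (simp add: regular_vec_def regular_def)

lemma regular_vec_linear:
  assumes "Vector_Spaces.linear (*s) (*s) g" "regular_vec F" shows "regular_vec (\<lambda>\<mu>. g (F \<mu>))"
proof (rule regular_vec_cong)
  show "g (F \<mu>) = F \<mu> $ 1 *s g e1 + F \<mu> $ 2 *s g e2" for \<mu>
    by (rule linear_vec2_expand[OF assms(1)])
  show "regular_vec (\<lambda>\<mu>. F \<mu> $ 1 *s g e1 + F \<mu> $ 2 *s g e2)"
    using assms(2) unfolding regular_vec_def[of F]
    by (intro regular_vec_add regular_vec_scale regular_vec_const) auto
qed

lemma regular_vec_mult2:
  assumes "regular_vec F" "regular_vec G"
  shows "regular_vec (\<lambda>\<mu>. \<mu> (F \<mu>) (G \<mu>))"
proof (rule regular_vec_cong)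
  have c: "regular_vec (\<lambda>\<mu>. \<mu> (axis i 1) (axis j 1))" for i j
    unfolding regular_vec_def regular_def
  proof
    show "\<exists>p\<in>polyfun_mults2. \<forall>\<mu>\<in>mults2. \<mu> (axis i 1) (axis j 1) $ l = p \<mu>" for l
      by (rule bexI[OF _ polyfun_mults2.coord[of i j l]]) simp
  qed
  show "regular_vec (\<lambda>\<mu>. (F \<mu> $ 1 * G \<mu> $ 1) *s \<mu> e1 e1 + (F \<mu> $ 1 * G \<mu> $ 2) *s \<mu> e1 e2
      + (F \<mu> $ 2 * G \<mu> $ 1) *s \<mu> e2 e1 + (F \<mu> $ 2 * G \<mu> $ 2) *s \<mu> e2 e2)"
    using assms unfolding regular_vec_def[of F] regular_vec_def[of G]
    by (intro regular_vec_add regular_vec_scale regular_mult c) auto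
  fix \<mu> :: "'a mult2" assume "\<mu> \<in> mults2"
  then show "\<mu> (F \<mu>) (G \<mu>) = (F \<mu> $ 1 * G \<mu> $ 1) *s \<mu> e1 e1 + (F \<mu> $ 1 * G \<mu> $ 2) *s \<mu> e1 e2
      + (F \<mu> $ 2 * G \<mu> $ 1) *s \<mu> e2 e1 + (F \<mu> $ 2 * G \<mu> $ 2) *s \<mu> e2 e2"
    using fun_cong[OF fun_cong[OF mults2_expand]] unfolding mult_table_def by blast
qed

lemmas regular_intros = regular_add regular_diff regular_mult regular_power regular_wedge
  regular_const regular_vec_mult2 regular_vec_add regular_vec_scale regular_vec_const

lemma closedin_regular:
  assumes "\<And>f. f \<in> S \<Longrightarrow> regular f"
  shows "closedin zariski_mults2 {\<mu> \<in> mults2. \<forall>f\<in>S. f \<mu> = 0}"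
proof -
  obtain P where P: "\<And>f. f \<in> S \<Longrightarrow> P f \<in> polyfun_mults2"
      "\<And>f \<mu>. f \<in> S \<Longrightarrow> \<mu> \<in> mults2 \<Longrightarrow> f \<mu> = P f \<mu>"
    using assms unfolding regular_def by metis
  then have "{\<mu> \<in> mults2. \<forall>f\<in>S. f \<mu> = 0} = zero_locus (P ` S)"
    by (auto simp: zero_locus_def)
  moreover have "P ` S \<subseteq> polyfun_mults2" using P(1) by (rule image_subsetI)
  ultimately show ?thesis unfolding closedin_zariski by (intro exI[of _ "P ` S"]) simp
qed

text \<open>For fixed \<open>g\<close> the action is linear in the structure constants, with
  coefficients coming from \<open>g\<close> and its inverse.\<close>

lemma regular_act:
  assumes g: "g \<in> GL2" and f: "f \<in> polyfun_mults2" shows "regular (\<lambda>\<mu>. f (act g \<mu>))"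
  using f
proof induction
  case (coord i j l)
  have "regular_vec (\<lambda>\<mu>. act g \<mu> (axis i 1) (axis j 1))"
    unfolding act_def
    by (intro regular_vec_linear[where g = g] regular_vec_mult2 regular_vec_const)
      (use g in \<open>simp add: GL2_def\<close>)
  then show ?case by (simp add: regular_vec_def)
qed (intro regular_intros; assumption)+

text \<open>The closure is the zero locus of all polynomials vanishing on the orbit, which trades
  the topology for polynomial identities.\<close>

lemma in_closure_orbit_iff:
  assumes "\<mu> \<in> mults2"
  shows "\<nu> \<in> zariski_mults2 closure_of orbit \<mu> \<longleftrightarrow>
    \<nu> \<in> mults2 \<and> (\<forall>f\<in>polyfun_mults2. (\<forall>\<rho>\<in>orbit \<mu>. f \<rho> = 0) \<longrightarrow> f \<nu> = 0)"
proof -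
  let ?I = "{f \<in> polyfun_mults2. \<forall>\<rho>\<in>orbit \<mu>. f \<rho> = 0}"
  have orb: "orbit \<mu> \<subseteq> mults2" using mults2_alg_iso assms by (auto simp: orbit_eq)
  have "zariski_mults2 closure_of orbit \<mu> = zero_locus ?I"
  proof (rule closure_of_unique)
    show "orbit \<mu> \<subseteq> zero_locus ?I" using orb by (auto simp: zero_locus_def)
    show "closedin zariski_mults2 (zero_locus ?I)"
      unfolding closedin_zariski by (intro exI[of _ ?I]) simp
    fix T assume "orbit \<mu> \<subseteq> T" "closedin zariski_mults2 T"
    then obtain F where F: "F \<subseteq> polyfun_mults2" "T = zero_locus F" "orbit \<mu> \<subseteq> T"
      unfolding closedin_zariski by (elim exE conjE)
    have "F \<subseteq> ?I" using F by (auto simp: zero_locus_def)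
    then show "zero_locus ?I \<subseteq> T" unfolding F(2) zero_locus_def by (intro Collect_mono) auto
  qed
  then show ?thesis by (auto simp: zero_locus_def)
qed

text \<open>An orbit closure is a union of orbits, since each \<open>g\<close> preserves the orbit
  and acts continuously; continuity appears here as pulling \<open>f\<close> back along
  \<open>g\<close>.\<close>

lemma closure_orbit_alg_iso:
  assumes "\<mu> \<in> mults2" "\<nu> \<in> zariski_mults2 closure_of orbit \<mu>" "\<nu> \<cong>\<^sub>a \<nu>'"
  shows "\<nu>' \<in> zariski_mults2 closure_of orbit \<mu>"
proof -
  obtain g where g: "g \<in> GL2" and \<nu>': "\<nu>' = act g \<nu>"
    using assms(3) by (auto simp: alg_iso_iff_act)
  have \<nu>: "\<nu> \<in> mults2" using assms(1,2) by (simp add: in_closure_orbit_iff)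
  have "f \<nu>' = 0" if f: "f \<in> polyfun_mults2" "\<forall>\<rho>\<in>orbit \<mu>. f \<rho> = 0" for f
  proof -
    obtain p where p: "p \<in> polyfun_mults2" "\<And>\<rho>. \<rho> \<in> mults2 \<Longrightarrow> f (act g \<rho>) = p \<rho>"
      using regular_act[OF g f(1)] by (auto simp: regular_def)
    have "p \<rho> = 0" if "\<rho> \<in> orbit \<mu>" for \<rho>
    proof -
      have "\<rho> \<cong>\<^sub>a act g \<rho>" using g by (auto simp: alg_iso_iff_act)
      then have "act g \<rho> \<in> orbit \<mu>" using that alg_iso_trans by (auto simp: orbit_eq)
      moreover have "\<rho> \<in> mults2" using that assms(1) mults2_alg_iso by (auto simp: orbit_eq)
      ultimately show ?thesis using f(2) p(2)[of \<rho>] by auto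
    qed
    then have "p \<nu> = 0" using assms(1,2) p(1) by (simp add: in_closure_orbit_iff)
    then show ?thesis using p(2)[OF \<nu>] \<nu>' by simp
  qed
  then show ?thesis
    using mults2_alg_iso[OF assms(3) \<nu>] assms(1) by (simp add: in_closure_orbit_iff)
qed

lemma degenerates_alg_iso:
  assumes "degenerates \<mu> \<nu>" "\<mu> \<cong>\<^sub>a \<mu>'" "\<nu> \<cong>\<^sub>a \<nu>'"
  shows "degenerates \<mu>' \<nu>'"
proof -
  have "orbit \<mu>' = orbit \<mu>"
    using assms(2) alg_iso_trans alg_iso_sym unfolding orbit_eq by blast
  then show ?thesis
    using assms terminal2_alg_iso closure_orbit_alg_iso
    by (auto simp: degenerates_def terminal2_def)
qed

lemma primary_degeneration_alg_iso:
  assumes "primary_degeneration \<mu> \<nu>" "\<mu> \<cong>\<^sub>a \<mu>'" "\<nu> \<cong>\<^sub>a \<nu>'"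
  shows "primary_degeneration \<mu>' \<nu>'"
proof -
  have rev: "\<mu>' \<cong>\<^sub>a \<mu>" "\<nu>' \<cong>\<^sub>a \<nu>" using assms alg_iso_sym by blast+
  have "degenerates \<mu>' \<nu>'"
    using assms(1) degenerates_alg_iso[OF _ assms(2,3)]
    by (simp add: primary_degeneration_def proper_degeneration_def)
  moreover have "\<not> \<mu>' \<cong>\<^sub>a \<nu>'"
    using assms(1) alg_iso_trans[OF alg_iso_trans[OF assms(2)] rev(2)]
    by (auto simp: primary_degeneration_def proper_degeneration_def)
  moreover have False
    if "\<not> \<rho> \<cong>\<^sub>a \<mu>'" "\<not> \<rho> \<cong>\<^sub>a \<nu>'" "degenerates \<mu>' \<rho>" "degenerates \<rho> \<nu>'" for \<rho>
  proof -
    have "degenerates \<mu> \<rho>" "degenerates \<rho> \<nu>"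
      using degenerates_alg_iso that(3,4) rev alg_iso_refl by blast+
    moreover have "\<not> \<rho> \<cong>\<^sub>a \<mu>" "\<not> \<rho> \<cong>\<^sub>a \<nu>" using that(1,2) assms(2,3) alg_iso_trans by blast+
    ultimately show False using assms(1) unfolding primary_degeneration_def by blast
  qed
  ultimately show ?thesis unfolding primary_degeneration_def proper_degeneration_def by blast
qed

text \<open>Along the family, a polynomial vanishing on the orbit becomes a polynomial in
  \<open>t\<close> that is zero for all \<open>t \<noteq> 0\<close>. The field is infinite, so it is
  also zero at \<open>t = 0\<close>.\<close>

lemma closure_orbit_curve:
  fixes \<mu> :: "'k::field_char_0 mult2"
    and a b c d :: "2 \<Rightarrow> 'k poly"
  defines "\<phi> \<equiv> \<lambda>t. mult_table (\<chi> i. poly (a i) t) (\<chi> i. poly (b i) t)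
    (\<chi> i. poly (c i) t) (\<chi> i. poly (d i) t)"
  assumes "\<mu> \<in> mults2" and curve: "\<And>t. t \<noteq> 0 \<Longrightarrow> \<mu> \<cong>\<^sub>a \<phi> t"
  shows "\<phi> 0 \<in> zariski_mults2 closure_of orbit \<mu>"
proof -
  have poly: "\<exists>p. \<forall>t. f (\<phi> t) = poly p t" if "f \<in> polyfun_mults2" for f
    using that
  proof induction
    case (coord i j l)
    have ij: "i = 1 \<or> i = 2" "j = 1 \<or> j = 2" using exhaust_2 by auto
    have "(\<forall>t. \<phi> t (axis i 1) (axis j 1) $ l = poly (a l) t) \<or>
      (\<forall>t. \<phi> t (axis i 1) (axis j 1) $ l = poly (b l) t) \<or>
      (\<forall>t. \<phi> t (axis i 1) (axis j 1) $ l = poly (c l) t) \<or>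
      (\<forall>t. \<phi> t (axis i 1) (axis j 1) $ l = poly (d l) t)"
      using ij by (auto simp: \<phi>_def)
    then show ?case by blast
  next
    case (const c)
    show ?case by (rule exI[of _ "[:c:]"]) simp
  next
    case (add f g)
    then show ?case by (metis poly_add)
  next
    case (mult f g)
    then show ?case by (metis poly_mult)
  qed
  have "f (\<phi> 0) = 0" if f: "f \<in> polyfun_mults2" "\<forall>\<rho>\<in>orbit \<mu>. f \<rho> = 0" for f
  proof -
    obtain p where p: "\<And>t. f (\<phi> t) = poly p t" using poly[OF f(1)] by blast
    have "poly p t = 0" if "t \<noteq> 0" for t
      using curve[OF that] f(2) p by (auto simp: orbit_eq)
    then have "UNIV - {0} \<subseteq> {t. poly p t = 0}" by blast
    moreover have "infinite (UNIV - {0 :: 'k})" by (simp add: infinite_UNIV_char_0)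
    ultimately have "p = 0" using poly_roots_finite finite_subset by blast
    then show ?thesis using p by simp
  qed
  then show ?thesis using assms(2) by (simp add: in_closure_orbit_iff \<phi>_def)
qed

section \<open>Closed invariant conditions\<close>

text \<open>The common zero set of the \<open>F i\<close> is closed and contains the orbit, hence
  also its closure. The index type carries the vectors over which an invariant quantifies, one
  equation for each choice.\<close>

lemma degenerates_preserves:
  fixes F :: "'i \<Rightarrow> 'k::field mult2 \<Rightarrow> 'k"
  assumes deg: "degenerates \<mu> \<nu>" and P: "P \<mu>"
    and iso: "\<And>\<mu> \<nu>. \<mu> \<cong>\<^sub>a \<nu> \<Longrightarrow> P \<mu> \<Longrightarrow> P \<nu>"
    and F: "\<And>\<mu>. P \<mu> \<longleftrightarrow> (\<forall>i. F i \<mu> = 0)" "\<And>i. regular (F i)"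
  shows "P \<nu>"
proof -
  have "orbit \<mu> \<subseteq> {\<rho> \<in> mults2. \<forall>f\<in>range F. f \<rho> = 0}"
    using deg P iso F(1) mults2_alg_iso by (auto simp: orbit_eq degenerates_def terminal2_def)
  then have "zariski_mults2 closure_of orbit \<mu> \<subseteq> {\<rho> \<in> mults2. \<forall>f\<in>range F. f \<rho> = 0}"
    by (rule closure_of_minimal) (use F(2) in \<open>blast intro: closedin_regular\<close>)
  then show ?thesis using deg F(1) by (auto simp: degenerates_def)
qed

text \<open>Every condition is written with \<^const>\<open>wedge\<close>, so that a change of basis multiplies both sides
  by the same power of its determinant.\<close>

lemma alg_iso_wedgeE:
  assumes "\<mu> \<cong>\<^sub>a \<nu>"
  obtains g h D where "D \<noteq> 0" "\<And>x. g (h x) = x" "\<And>x y. \<nu> (g x) (g y) = g (\<mu> x y)"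
    "\<And>x y. wedge (g x) (g y) = D * wedge x y" "\<And>x y. g (x + y) = g x + g y"
proof -
  obtain g where g: "g \<in> GL2" "\<And>x y. g (\<mu> x y) = \<nu> (g x) (g y)"
    using assms by (auto simp: alg_iso_def)
  obtain D where "D \<noteq> 0" "\<And>x y. wedge (g x) (g y) = D * wedge x y" using GL2_wedge[OF g(1)] by blast
  moreover have "g (inv g x) = x" for x
    using g(1) by (simp add: GL2_def bij_is_surj surj_f_inv_f)
  ultimately show ?thesis using that[of D g "inv g"] g by (simp add: GL2_def linear_vec2_iff)
qed

text \<open>The traces of left and right multiplication operators are proportional, as \<open>s\<close> to \<open>t\<close>.\<close>

definition trace_ratio :: "'k::field \<Rightarrow> 'k \<Rightarrow> 'k mult2 \<Rightarrow> bool"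
  where "trace_ratio s t \<mu> \<longleftrightarrow> (\<forall>x y z.
    t * (wedge (\<mu> x y) z + wedge y (\<mu> x z)) = s * (wedge (\<mu> y x) z + wedge y (\<mu> z x)))"

text \<open>The left multiplication operators span a space of dimension at most one.\<close>

definition left_rank_le_1 :: "'k::field mult2 \<Rightarrow> bool"
  where "left_rank_le_1 \<mu> \<longleftrightarrow> (\<forall>x y u v p q.
    wedge (\<mu> x u) p * wedge (\<mu> y v) q = wedge (\<mu> y u) p * wedge (\<mu> x v) q)"

text \<open>The operators \<open>2 L\<^sub>x + R\<^sub>x\<close> have a characteristic polynomial with a double root.\<close>

definition double_root :: "'k::field mult2 \<Rightarrow> bool"
  where "double_root \<mu> \<longleftrightarrow> (\<forall>x y z.
    (wedge (\<mu> x y + \<mu> x y + \<mu> y x) z + wedge y (\<mu> x z + \<mu> x z + \<mu> z x))^2 =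
    4 * wedge (\<mu> x y + \<mu> x y + \<mu> y x) (\<mu> x z + \<mu> x z + \<mu> z x) * wedge y z)"

text \<open>The binary cubic that defines the eigenlines vanishes identically; equivalently, every
  line through the origin is a subalgebra.\<close>

definition square_collinear :: "'k::field mult2 \<Rightarrow> bool"
  where "square_collinear \<mu> \<longleftrightarrow> (\<forall>x. wedge (\<mu> x x) x = 0)"

text \<open>Pairing with an arbitrary \<open>w\<close> turns the vector identity into scalar
  equations, in the style of the other invariants.\<close>

definition associative :: "'k::field mult2 \<Rightarrow> bool"
  where "associative \<mu> \<longleftrightarrow> (\<forall>x y z w. wedge (\<mu> (\<mu> x y) z) w = wedge (\<mu> x (\<mu> y z)) w)"

section \<open>Invariance under isomorphism\<close>

lemma trace_ratio_alg_iso: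
  assumes "\<mu> \<cong>\<^sub>a \<nu>" "trace_ratio s t \<mu>" shows "trace_ratio s t \<nu>"
  using assms(1)
proof (rule alg_iso_wedgeE)
  fix g h D assume g: "D \<noteq> 0" "\<And>x. g (h x) = x" "\<And>x y. \<nu> (g x) (g y) = g (\<mu> x y)"
    "\<And>x y. wedge (g x) (g y) = D * wedge x y"
  have "t * (wedge (\<nu> (g x) (g y)) (g z) + wedge (g y) (\<nu> (g x) (g z))) =
    s * (wedge (\<nu> (g y) (g x)) (g z) + wedge (g y) (\<nu> (g z) (g x)))" for x y z
  proof -
    have "D * (t * (wedge (\<mu> x y) z + wedge y (\<mu> x z))) = D * (s * (wedge (\<mu> y x) z + wedge y (\<mu> z x)))"
      using assms(2) by (simp add: trace_ratio_def)
    then show ?thesis by (simp add: g algebra_simps)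
  qed
  \<comment> \<open>Every vector has the form \<open>g (h x)\<close>, so an identity on values of
    \<open>g\<close> holds everywhere.\<close>
  from this[of "h _" "h _" "h _"] show ?thesis by (simp add: g trace_ratio_def)
qed

lemma left_rank_le_1_alg_iso:
  assumes "\<mu> \<cong>\<^sub>a \<nu>" "left_rank_le_1 \<mu>" shows "left_rank_le_1 \<nu>"
  using assms(1)
proof (rule alg_iso_wedgeE)
  fix g h D assume g: "D \<noteq> 0" "\<And>x. g (h x) = x" "\<And>x y. \<nu> (g x) (g y) = g (\<mu> x y)"
    "\<And>x y. wedge (g x) (g y) = D * wedge x y"
  have "wedge (\<nu> (g x) (g u)) (g p) * wedge (\<nu> (g y) (g v)) (g q) =
    wedge (\<nu> (g y) (g u)) (g p) * wedge (\<nu> (g x) (g v)) (g q)" for x y u v p q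
  proof -
    have "D^2 * (wedge (\<mu> x u) p * wedge (\<mu> y v) q) = D^2 * (wedge (\<mu> y u) p * wedge (\<mu> x v) q)"
      using assms(2) by (simp add: left_rank_le_1_def)
    then show ?thesis by (simp add: g algebra_simps power2_eq_square)
  qed
  from this[of "h _" "h _" "h _" "h _" "h _" "h _"] show ?thesis by (simp add: g left_rank_le_1_def)
qed

text \<open>Both sides are quadratic in \<open>wedge\<close> and scale by the square of the
  determinant. The factor 2 of the left multiplication is a repeated summand, so additivity of
  \<open>g\<close> suffices to move it through.\<close>

lemma double_root_alg_iso:
  assumes "\<mu> \<cong>\<^sub>a \<nu>" "double_root \<mu>" shows "double_root \<nu>"
  using assms(1)
proof (rule alg_iso_wedgeE)
  fix g h D assume g: "D \<noteq> 0" "\<And>x. g (h x) = x" "\<And>x y. \<nu> (g x) (g y) = g (\<mu> x y)"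
    "\<And>x y. wedge (g x) (g y) = D * wedge x y" "\<And>x y. g (x + y) = g x + g y"
  have "(wedge (\<nu> (g x) (g y) + \<nu> (g x) (g y) + \<nu> (g y) (g x)) (g z)
      + wedge (g y) (\<nu> (g x) (g z) + \<nu> (g x) (g z) + \<nu> (g z) (g x)))^2 =
    4 * wedge (\<nu> (g x) (g y) + \<nu> (g x) (g y) + \<nu> (g y) (g x))
      (\<nu> (g x) (g z) + \<nu> (g x) (g z) + \<nu> (g z) (g x)) * wedge (g y) (g z)" for x y z
  proof -
    let ?y = "\<mu> x y + \<mu> x y + \<mu> y x" and ?z = "\<mu> x z + \<mu> x z + \<mu> z x"
    have "D^2 * (wedge ?y z + wedge y ?z)^2 = D^2 * (4 * wedge ?y ?z * wedge y z)"
      using assms(2) by (simp add: double_root_def)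
    then have "(D * wedge ?y z + D * wedge y ?z)^2 = 4 * (D * wedge ?y ?z) * (D * wedge y z)"
      by (simp add: power_mult_distrib power2_eq_square algebra_simps)
    then show ?thesis unfolding g(3) g(5)[symmetric] g(4) .
  qed
  from this[of "h _" "h _" "h _"] show ?thesis by (simp add: g(2) double_root_def)
qed

lemma square_collinear_alg_iso:
  assumes "\<mu> \<cong>\<^sub>a \<nu>" "square_collinear \<mu>" shows "square_collinear \<nu>"
  using assms(1)
proof (rule alg_iso_wedgeE)
  fix g h D assume g: "\<And>x. g (h x) = x" "\<And>x y. \<nu> (g x) (g y) = g (\<mu> x y)"
    "\<And>x y. wedge (g x) (g y) = D * wedge x y"
  have "wedge (\<nu> (g x) (g x)) (g x) = 0" for x
    using assms(2) by (simp add: g square_collinear_def)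
  from this[of "h _"] show ?thesis by (simp add: g square_collinear_def)
qed

lemma associative_alg_iso:
  assumes "\<mu> \<cong>\<^sub>a \<nu>" "associative \<mu>" shows "associative \<nu>"
  using assms(1)
proof (rule alg_iso_wedgeE)
  fix g h D assume g: "\<And>x. g (h x) = x" "\<And>x y. \<nu> (g x) (g y) = g (\<mu> x y)"
    "\<And>x y. wedge (g x) (g y) = D * wedge x y"
  have "wedge (\<nu> (\<nu> (g x) (g y)) (g z)) (g w) = wedge (\<nu> (g x) (\<nu> (g y) (g z))) (g w)" for x y z w
    using assms(2) by (simp add: g associative_def)
  from this[of "h _" "h _" "h _" "h _"] show ?thesis by (simp add: g associative_def)
qed

section \<open>Stability of the invariants under degeneration\<close>

lemma degenerates_trace_ratio:
  assumes "degenerates \<mu> \<nu>" "trace_ratio s t \<mu>" shows "trace_ratio s t \<nu>"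
proof (rule degenerates_preserves[where P = "trace_ratio s t" and F = "\<lambda>(x, y, z) \<mu>.
    t * (wedge (\<mu> x y) z + wedge y (\<mu> x z)) - s * (wedge (\<mu> y x) z + wedge y (\<mu> z x))",
    OF assms trace_ratio_alg_iso])
  fix i :: "('a^2) \<times> ('a^2) \<times> ('a^2)"
  show "regular (case i of (x, y, z) \<Rightarrow> \<lambda>\<mu>.
    t * (wedge (\<mu> x y) z + wedge y (\<mu> x z)) - s * (wedge (\<mu> y x) z + wedge y (\<mu> z x)))"
    by (cases i) (simp only: prod.case, intro regular_intros)
qed (auto simp: trace_ratio_def)

lemma degenerates_left_rank_le_1:
  assumes "degenerates \<mu> \<nu>" "left_rank_le_1 \<mu>" shows "left_rank_le_1 \<nu>"
proof (rule degenerates_preserves[where P = "left_rank_le_1" and F = "\<lambda>(x, y, u, v, p, q) \<mu>.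
    wedge (\<mu> x u) p * wedge (\<mu> y v) q - wedge (\<mu> y u) p * wedge (\<mu> x v) q",
    OF assms left_rank_le_1_alg_iso])
  fix i :: "('a^2) \<times> ('a^2) \<times> ('a^2) \<times> ('a^2) \<times> ('a^2) \<times> ('a^2)"
  show "regular (case i of (x, y, u, v, p, q) \<Rightarrow> \<lambda>\<mu>.
    wedge (\<mu> x u) p * wedge (\<mu> y v) q - wedge (\<mu> y u) p * wedge (\<mu> x v) q)"
    by (cases i) (simp only: prod.case, intro regular_intros)
qed (auto simp: left_rank_le_1_def)

lemma degenerates_double_root:
  assumes "degenerates \<mu> \<nu>" "double_root \<mu>" shows "double_root \<nu>"
proof (rule degenerates_preserves[where P = "double_root" and F = "\<lambda>(x, y, z) \<mu>.
    (wedge (\<mu> x y + \<mu> x y + \<mu> y x) z + wedge y (\<mu> x z + \<mu> x z + \<mu> z x))^2 -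
    4 * wedge (\<mu> x y + \<mu> x y + \<mu> y x) (\<mu> x z + \<mu> x z + \<mu> z x) * wedge y z",
    OF assms double_root_alg_iso])
  fix i :: "('a^2) \<times> ('a^2) \<times> ('a^2)"
  show "regular (case i of (x, y, z) \<Rightarrow> \<lambda>\<mu>.
    (wedge (\<mu> x y + \<mu> x y + \<mu> y x) z + wedge y (\<mu> x z + \<mu> x z + \<mu> z x))^2 -
    4 * wedge (\<mu> x y + \<mu> x y + \<mu> y x) (\<mu> x z + \<mu> x z + \<mu> z x) * wedge y z)"
    by (cases i) (simp only: prod.case, intro regular_intros)
qed (auto simp: double_root_def)

lemma degenerates_square_collinear:
  assumes "degenerates \<mu> \<nu>" "square_collinear \<mu>" shows "square_collinear \<nu>"
proof (rule degenerates_preserves[where P = square_collinear and F = "\<lambda>x \<mu>. wedge (\<mu> x x) x", OF assms])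
  show "square_collinear \<sigma>" if "\<rho> \<cong>\<^sub>a \<sigma>" "square_collinear \<rho>" for \<rho> \<sigma> :: "'a mult2"
    using that by (rule square_collinear_alg_iso)
  show "regular (\<lambda>\<mu>. wedge (\<mu> x x) x)" for x :: "'a^2" by (intro regular_intros)
qed (simp add: square_collinear_def)

lemma degenerates_associative:
  assumes "degenerates \<mu> \<nu>" "associative \<mu>" shows "associative \<nu>"
proof (rule degenerates_preserves[where P = "associative" and F = "\<lambda>(x, y, z, w) \<mu>.
    wedge (\<mu> (\<mu> x y) z) w - wedge (\<mu> x (\<mu> y z)) w",
    OF assms associative_alg_iso])
  fix i :: "('a^2) \<times> ('a^2) \<times> ('a^2) \<times> ('a^2)"
  show "regular (case i of (x, y, z, w) \<Rightarrow> \<lambda>\<mu>.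
    wedge (\<mu> (\<mu> x y) z) w - wedge (\<mu> x (\<mu> y z)) w)"
    by (cases i) (simp only: prod.case, intro regular_intros)
qed (auto simp: associative_def)

text \<open>For an operator A of the plane, \<open>wedge (A y) z + wedge y (A z)\<close> is the
  trace of A times \<open>wedge y z\<close>. The sums \<open>a$1 + b$2\<close> and
  \<open>c$1 + d$2\<close> are the traces of left multiplication by \<open>e1\<close> and
  \<open>e2\<close>; \<open>a$1 + c$2\<close> and \<open>b$1 + d$2\<close> are those of right
  multiplication.\<close>

lemma trace_ratio_mult_table:
  "trace_ratio s t (mult_table a b c d) \<longleftrightarrow>
    t * (a$1 + b$2) = s * (a$1 + c$2) \<and> t * (c$1 + d$2) = s * (b$1 + d$2)"
  (is "?L \<longleftrightarrow> ?R")
proof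
  assume ?L
  note r = this[unfolded trace_ratio_def, rule_format]
  show ?R using r[of e1 e1 e2] r[of e2 e1 e2] by (simp add: wedge_def)
next
  assume R: ?R
  have "t * (wedge (mult_table a b c d x y) z + wedge y (mult_table a b c d x z)) =
     (x$1 * (t * (a$1 + b$2)) + x$2 * (t * (c$1 + d$2))) * wedge y z" for x y z
    by (simp add: mult_table_def wedge_def algebra_simps)
  moreover have "s * (wedge (mult_table a b c d y x) z + wedge y (mult_table a b c d z x)) =
     (x$1 * (s * (a$1 + c$2)) + x$2 * (s * (b$1 + d$2))) * wedge y z" for x y z
    by (simp add: mult_table_def wedge_def algebra_simps)
  ultimately show ?L using R by (simp add: trace_ratio_def)
qed

text \<open>These are 2 by 2 minors of the matrix whose rows list the left multiplications by
  \<open>e1\<close> and \<open>e2\<close>.\<close>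

lemma left_rank_le_1_mult_tableD:
  assumes "left_rank_le_1 (mult_table a b c d)"
  shows "a$i * d$j = c$i * b$j" "a$1 * c$2 = c$1 * a$2" "b$1 * d$2 = d$1 * b$2"
proof -
  have w: "wedge w e2 = w$1" "wedge w (- e1) = w$2" for w :: "'a^2" by (simp_all add: wedge_def)
  note r = assms[unfolded left_rank_le_1_def, rule_format]
  have "i = 1 \<or> i = 2" "j = 1 \<or> j = 2" using exhaust_2 by auto
  then show "a$i * d$j = c$i * b$j"
    using r[of e1 e1 e2 e2 e2 e2] r[of e1 e1 e2 e2 e2 "- e1"]
      r[of e1 e1 "- e1" e2 e2 e2] r[of e1 e1 "- e1" e2 e2 "- e1"] by (auto simp: w)
  show "a$1 * c$2 = c$1 * a$2" using r[of e1 e1 e2 e2 e1 "- e1"] by (simp add: w)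
  show "b$1 * d$2 = d$1 * b$2" using r[of e1 e2 e2 e2 e2 "- e1"] by (simp add: w)
qed

text \<open>The discriminant of a 2 by 2 matrix is (m11 - m22)^2 + 4 m12 m21. The columns of 2 L + R
  are \<open>3 a\<close>, \<open>2 b + c\<close> at \<open>e1\<close> and \<open>2 c + b\<close>,
  \<open>3 d\<close> at \<open>e2\<close>.\<close>

lemma double_root_mult_tableD:
  assumes "double_root (mult_table a b c d)"
  shows "(3 * a$1 - (2 * b$2 + c$2))^2 + 4 * (2 * b$1 + c$1) * (3 * a$2) = 0"
    and "(2 * c$1 + b$1 - 3 * d$2)^2 + 4 * (3 * d$1) * (2 * c$2 + b$2) = 0"
proof -
  note r = assms[unfolded double_root_def, rule_format]
  show "(3 * a$1 - (2 * b$2 + c$2))^2 + 4 * (2 * b$1 + c$1) * (3 * a$2) = 0"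
    using r[of e1 e1 e2] by (simp add: wedge_def) algebra
  show "(2 * c$1 + b$1 - 3 * d$2)^2 + 4 * (3 * d$1) * (2 * c$2 + b$2) = 0"
    using r[of e2 e1 e2] by (simp add: wedge_def) algebra
qed

lemma square_collinear_mult_table:
  fixes a b c d :: "'k::field_char_0^2"
  shows "square_collinear (mult_table a b c d) \<longleftrightarrow>
    a$2 = 0 \<and> d$1 = 0 \<and> a$1 = b$2 + c$2 \<and> d$2 = b$1 + c$1"
  (is "?L \<longleftrightarrow> ?R")
proof
  assume L: ?L
  note r = L[unfolded square_collinear_def, rule_format]
  have 1: "a$2 = 0" "d$1 = 0" using r[of e1] r[of e2] by (simp_all add: wedge_def)
  \<comment> \<open>A binary cubic vanishing on four distinct lines is zero; the two extra lines
    give the sum and the difference of the middle coefficients.\<close>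
  have "a$1 - (b$2 + c$2) + (b$1 + c$1 - d$2) = 0" "a$1 - (b$2 + c$2) - (b$1 + c$1 - d$2) = 0"
    using r[of "e1 + e2"] r[of "e1 - e2"] 1 by (simp_all add: mult_table_def wedge_def algebra_simps)
  then have "2 * (a$1 - (b$2 + c$2)) = 0" "2 * (b$1 + c$1 - d$2) = 0" by algebra+
  then have "a$1 - (b$2 + c$2) = 0" "b$1 + c$1 - d$2 = 0" by (simp_all only: mult_eq_0_iff) simp_all
  then show ?R using 1 by simp
next
  assume ?R
  then show ?L by (simp add: square_collinear_def mult_table_def wedge_def algebra_simps)
qed

lemmas T_defs = T01_def T02_def T03_def T04_def T05_def T06_def T07_def T08_def T09_def T10_def
  zero_alg_def

lemma left_rank_le_1_of_factor:
  assumes "\<And>x y. \<mu> x y = f x *s L y" shows "left_rank_le_1 \<mu>"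
  by (simp add: left_rank_le_1_def assms wedge_def algebra_simps)

lemma left_rank_le_1_T: "left_rank_le_1 T01" "left_rank_le_1 T04" "left_rank_le_1 (T07 \<alpha>)"
proof -
  show "left_rank_le_1 T01"
    by (rule left_rank_le_1_of_factor[of _ "\<lambda>x. x$1" "\<lambda>y. y$1 *s (e1 + e2) + y$2 *s e2"])
      (simp add: T01_def mult_table_def vec2_eq_iff algebra_simps)
  show "left_rank_le_1 T04"
    by (rule left_rank_le_1_of_factor[of _ "\<lambda>x. x$2" "\<lambda>y. y$1 *s e1"])
      (simp add: T04_def mult_table_def vec2_eq_iff algebra_simps)
  show "left_rank_le_1 (T07 \<alpha>)"
    by (rule left_rank_le_1_of_factor[of _ "\<lambda>x. x$1" "\<lambda>y. y$1 *s e1 + (y$2 * \<alpha>) *s e2"])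
      (simp add: T07_def mult_table_def vec2_eq_iff algebra_simps)
qed

text \<open>In each of these tables all operators 2 L_x + R_x are triangular in the standard basis,
  with equal diagonal entries.\<close>

lemma double_root_T: "double_root T02" "double_root T05" "double_root (T08 \<alpha>)"
  by (simp_all add: double_root_def T_defs mult_table_def wedge_def algebra_simps power2_eq_square)

lemma associative_T09: "associative T09"
  by (simp add: associative_def T09_def mult_table_def wedge_def)

lemma not_associative_T10: "\<not> associative (T10 (1/2 :: 'k::field_char_0))"
proof
  assume "associative (T10 (1/2 :: 'k))"
  \<comment> \<open>The product (e1 e1) e2 has \<open>e2\<close>-coefficient 1/2, whereas e1 (e1 e2)
    has 1/4.\<close>
  from this[unfolded associative_def, rule_format, of e1 e1 e2 e1]
  show False by (simp add: T10_def mult_table_def wedge_def)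
qed

lemma terminal2_T:
  "T01 \<in> terminal2" "T02 \<in> terminal2" "T03 \<in> terminal2" "T04 \<in> terminal2" "T05 \<in> terminal2"
  "T06 \<in> terminal2" "T07 \<alpha> \<in> terminal2" "T08 \<alpha> \<in> terminal2" "T09 \<in> terminal2"
  "T10 \<alpha> \<in> terminal2" "zero_alg \<in> terminal2"
  by (simp_all add: terminal2_def T_defs)
   (simp_all add: bracket_bil_bil_def bracket_lin_bil_def bracket_bil_elem_def mult_table_def
     vec2_eq_iff algebra_simps)

section \<open>Classification of the terminal multiplications\<close>

definition vec2 :: "'k::field \<Rightarrow> 'k \<Rightarrow> 'k^2"
  where "vec2 x y = x *s e1 + y *s e2"

lemma vec2_nth [simp]: "vec2 x y $ 1 = x" "vec2 x y $ 2 = y"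
  by (simp_all add: vec2_def)

abbreviation table8 where
  "table8 a1 a2 b1 b2 c1 c2 d1 d2 \<equiv> mult_table (vec2 a1 a2) (vec2 b1 b2) (vec2 c1 c2) (vec2 d1 d2)"

lemma T_table8:
  "T01 = table8 1 1 0 1 0 0 0 0" "T02 = table8 1 1 0 2 0 (-1) 0 0" "T03 = table8 0 1 0 0 0 0 0 0"
  "T04 = table8 0 0 0 0 1 0 0 0" "T05 = table8 0 0 2 0 (-1) 0 0 0" "T06 = table8 0 0 0 1 0 (-1) 0 0"
  "T07 \<alpha> = table8 1 0 0 \<alpha> 0 0 0 0" "T08 \<alpha> = table8 1 0 0 \<alpha> 0 (3 - 2 * \<alpha>) 0 0"
  "T09 = table8 1 0 0 0 0 0 0 1" "T10 \<alpha> = table8 1 0 (1 - \<alpha>) \<alpha> \<alpha> (1 - \<alpha>) 0 1"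
  "zero_alg = table8 0 0 0 0 0 0 0 0"
  unfolding T_defs by (rule arg_cong4[where f = mult_table]; simp add: vec2_eq_iff)+

definition normal_forms :: "'k::field mult2 set"
  where "normal_forms = {T01, T02, T03, T04, T05, T06, T09, zero_alg} \<union> {T07 \<alpha> | \<alpha>. \<alpha> \<noteq> 1}
    \<union> {T08 \<alpha> | \<alpha>. \<alpha> \<noteq> 2 \<and> \<alpha> \<noteq> 3 / 2} \<union> range T10"

definition classified :: "'k::field mult2 \<Rightarrow> bool"
  where "classified \<mu> \<longleftrightarrow> (\<exists>\<nu>\<in>normal_forms. \<mu> \<cong>\<^sub>a \<nu>)"

lemma classified_alg_iso: "\<mu> \<cong>\<^sub>a \<nu> \<Longrightarrow> classified \<nu> \<Longrightarrow> classified \<mu>"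
  unfolding classified_def using alg_iso_trans by blast

lemma classified_normal_form: "\<nu> \<in> normal_forms \<Longrightarrow> classified \<nu>"
  unfolding classified_def using alg_iso_refl by blast

lemma normal_forms_T:
  "T01 \<in> normal_forms" "T02 \<in> normal_forms" "T03 \<in> normal_forms" "T04 \<in> normal_forms"
  "T05 \<in> normal_forms" "T06 \<in> normal_forms" "T09 \<in> normal_forms" "zero_alg \<in> normal_forms"
  "T10 \<alpha> \<in> normal_forms"
  by (simp_all add: normal_forms_def)

lemma normal_forms_T07: "\<alpha> \<noteq> 1 \<Longrightarrow> T07 \<alpha> \<in> normal_forms"
  unfolding normal_forms_def by (rule UnI1, rule UnI1, rule UnI2) auto

lemma normal_forms_T08: "\<alpha> \<noteq> 2 \<Longrightarrow> \<alpha> \<noteq> 3 / 2 \<Longrightarrow> T08 \<alpha> \<in> normal_forms"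
  unfolding normal_forms_def by (rule UnI1, rule UnI2) auto

lemma classified_T:
  "classified T01" "classified T02" "classified T03" "classified T04" "classified T05"
  "classified T06" "classified T09" "classified zero_alg" "\<alpha> \<noteq> 1 \<Longrightarrow> classified (T07 \<alpha>)"
  "\<alpha> \<noteq> 2 \<Longrightarrow> \<alpha> \<noteq> 3 / 2 \<Longrightarrow> classified (T08 \<alpha>)" "classified (T10 \<alpha>)"
  by (simp_all add: classified_normal_form normal_forms_T normal_forms_T07 normal_forms_T08)

text \<open>A change of basis checked in coordinates; \<open>\<mu>\<close> merely abbreviates the
  source table. The leading positional arguments are \<open>u1\<close>, \<open>v2\<close>,
  \<open>u2\<close>, \<open>v1\<close>, so \<open>1 1 0 s\<close> denotes the basis e1, e2 + s
  e1.\<close>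

lemma table8_alg_isoI:
  assumes "u1 * v2 - u2 * v1 \<noteq> 0" "\<mu> = table8 a1 a2 b1 b2 c1 c2 d1 d2"
    "\<mu> (vec2 u1 u2) (vec2 u1 u2) = vec2 (p1 * u1 + p2 * v1) (p1 * u2 + p2 * v2)"
    "\<mu> (vec2 u1 u2) (vec2 v1 v2) = vec2 (q1 * u1 + q2 * v1) (q1 * u2 + q2 * v2)"
    "\<mu> (vec2 v1 v2) (vec2 u1 u2) = vec2 (r1 * u1 + r2 * v1) (r1 * u2 + r2 * v2)"
    "\<mu> (vec2 v1 v2) (vec2 v1 v2) = vec2 (s1 * u1 + s2 * v1) (s1 * u2 + s2 * v2)"
  shows "table8 a1 a2 b1 b2 c1 c2 d1 d2 \<cong>\<^sub>a table8 p1 p2 q1 q2 r1 r2 s1 s2"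
  unfolding assms(2)[symmetric]
  by (rule alg_iso_tableI[of _ "vec2 u1 u2" "vec2 v1 v2"])
    (use assms(1) in \<open>simp_all add: assms(3-6), simp_all add: assms(2) wedge_def vec2_eq_iff\<close>)

lemma table8_apply:
  "table8 a1 a2 b1 b2 c1 c2 d1 d2 (vec2 x1 x2) (vec2 y1 y2) =
    vec2 (x1 * y1 * a1 + x1 * y2 * b1 + x2 * y1 * c1 + x2 * y2 * d1)
         (x1 * y1 * a2 + x1 * y2 * b2 + x2 * y1 * c2 + x2 * y2 * d2)"
  by (simp add: mult_table_def vec2_eq_iff)

text \<open>The substitution fixes \<open>e1\<close>, hence also its action \<open>b\<close>,
  \<open>d\<close> modulo the line of \<open>e1\<close>. The entries \<open>a\<close> and
  \<open>c\<close> move by multiples of \<open>\<epsilon> - b\<close> and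
  \<open>\<epsilon> - d\<close>, which decides which of them can be cleared.\<close>

lemma table8_shift:
  "table8 \<epsilon> 0 a b c d p q \<cong>\<^sub>a table8 \<epsilon> 0 (a + s * (\<epsilon> - b)) b (c + s * (\<epsilon> - d)) d
    (p + s * (a + c) + s * s * \<epsilon> - s * (q + s * (b + d))) (q + s * (b + d))"
  by (rule table8_alg_isoI[of 1 1 0 s, OF _ refl])
    (simp_all add: table8_apply algebra_simps)

lemma terminal2_eq:
  "\<mu> \<in> terminal2 \<Longrightarrow>
    bracket_bil_bil (bracket_lin_bil (bracket_bil_elem \<mu> a) \<mu>) \<mu> x y z $ i = 0"
  by (simp add: terminal2_def)

lemmas bracket_defs = bracket_bil_bil_def bracket_lin_bil_def bracket_bil_elem_def

text \<open>This coordinate of the terminal identity involves only the action of \<open>e1\<close>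
  modulo its line. Its factors are, in order, the sources of \<open>T07\<close>, \<open>T08\<close>
  and \<open>T10\<close>; \<open>T09\<close> arises from the first two.\<close>

lemma eigenline_idempotent:
  fixes a b c d p q :: "'k::field_char_0"
  assumes "table8 1 0 a b c d p q \<in> terminal2"
  shows "d * ((2 * b + d - 3) * (b + d - 1)) = 0"
  using terminal2_eq[OF assms, of e2 e1 e1 e1 2]
  by (simp add: bracket_defs mult_table_def) algebra

text \<open>When the square of \<open>e1\<close> is zero, only the terms of top degree in
  \<open>b\<close> and \<open>d\<close> survive.\<close>

lemma eigenline_nilpotent:
  fixes a b c d p q :: "'k::field_char_0"
  assumes "table8 0 0 a b c d p q \<in> terminal2"
  shows "d * ((2 * b + d) * (b + d)) = 0"
  using terminal2_eq[OF assms, of e2 e1 e1 e1 2]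
  by (simp add: bracket_defs mult_table_def) algebra

section \<open>Tables whose first basis vector is idempotent\<close>

lemma classified_idempotent_d0:
  fixes a b p q :: "'k::field_char_0"
  assumes "table8 1 0 a b 0 0 p q \<in> terminal2"
  shows "classified (table8 1 0 a b 0 0 p q)"
proof -
  note E = terminal2_eq[OF assms]
  have a: "a = 0" using E[of e1 e2 e1 e1 1] by (simp add: bracket_defs mult_table_def algebra_simps)
  have p: "p = 0" using E[of e2 e2 e1 e1 1] a
    by (simp add: bracket_defs mult_table_def algebra_simps)
  have "b * q^2 = 0" using E[of e2 e1 e2 e2 2] a p
    by (simp add: bracket_defs mult_table_def algebra_simps power2_eq_square)
  \<comment> \<open>The value \<open>b = 1\<close> is split off because the table is then
    \<open>T10 1\<close>, seen in the basis of idempotents e1, e1 + e2.\<close>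
  then consider "q = 0" "b \<noteq> 1" | "q = 0" "b = 1" | "b = 0" "q \<noteq> 0" by auto
  then show ?thesis
  proof cases
    case 1
    then show ?thesis using classified_T(9)[of b] a p by (simp add: T_table8)
  next
    case 2
    have "table8 1 0 a b 0 0 p q \<cong>\<^sub>a T10 1" unfolding T_table8
      by (rule table8_alg_isoI[of 1 1 0 1, OF _ refl]) (simp_all add: table8_apply a p 2)
    then show ?thesis using classified_T(11) classified_alg_iso by blast
  next
    case 3
    have "table8 1 0 a b 0 0 p q \<cong>\<^sub>a T09" unfolding T_table8
      by (rule table8_alg_isoI[of 1 "1 / q" 0 0, OF _ refl]) (use 3 in \<open>simp_all add: table8_apply a p\<close>)
    then show ?thesis using classified_T(7) classified_alg_iso by blast
  qed
qed

text \<open>The identity makes \<open>e1\<close> a unit, so the algebra is k[x] / (x^2 - q x - p).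
  Distinct roots give \<open>T09\<close>, a double root gives the dual numbers
  \<open>T08 1\<close>.\<close>

lemma classified_unital:
  fixes a c p q :: "'k::{alg_closed_field, field_char_0}"
  assumes "table8 1 0 a 1 c 1 p q \<in> terminal2"
  shows "classified (table8 1 0 a 1 c 1 p q)"
proof -
  note E = terminal2_eq[OF assms]
  have "2 * a = 0" using E[of e1 e1 e2 e2 2]
    by (simp add: bracket_defs mult_table_def algebra_simps)
  then have a: "a = 0" by simp
  have c: "c = 0" using E[of e2 e1 e1 e2 2] a by (simp add: bracket_defs mult_table_def algebra_simps)
  \<comment> \<open>For a root \<open>s\<close>, the square of e2 - s e1 is a multiple of e2 - s
    e1.\<close>
  have "\<exists>s. poly [:- p, - q, 1:] s = 0" by (rule alg_closed_imp_poly_has_root) simp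
  then obtain s where "poly [:- p, - q, 1:] s = 0" ..
  then have s: "p = s * s - s * q" by (simp add: algebra_simps)
  define r where "r = q - 2 * s"
  have 1: "table8 1 0 a 1 c 1 p q \<cong>\<^sub>a table8 1 0 0 1 0 1 0 r"
  proof -
    have "p + s * s + s * (q - s * 2) = 0" "q - s * 2 = r" by (simp_all add: r_def s algebra_simps)
    then show ?thesis using table8_shift[of 1 a 1 c 1 p q "- s"] a c by simp
  qed
  show ?thesis
  proof (cases "r = 0")
    case True
    have "(3::'k) / 2 \<noteq> 1" by simp
    then show ?thesis
      using classified_alg_iso[OF 1] classified_T(10)[of "1 :: 'k"] True by (simp add: T_table8)
  next
    case False
    \<comment> \<open>The vectors e1 - e2/r and e2/r are orthogonal idempotents.\<close>
    have "table8 1 0 0 1 0 1 0 r \<cong>\<^sub>a T09" unfolding T_table8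
      by (rule table8_alg_isoI[of 1 "1 / r" "- 1 / r" 0, OF _ refl])
        (use False in \<open>simp_all add: table8_apply field_simps\<close>)
    then show ?thesis using classified_T(7) classified_alg_iso 1 by blast
  qed
qed

lemma classified_T08_shape:
  fixes a b p q :: "'k::field_char_0"
  assumes "table8 1 0 a b 0 (3 - 2 * b) p q \<in> terminal2" "b \<noteq> 1" "b \<noteq> 3 / 2"
  shows "classified (table8 1 0 a b 0 (3 - 2 * b) p q)"
proof -
  note E = terminal2_eq[OF assms(1)]
  have "4 * (a * (b - 1)^2) = 0" using E[of e1 e2 e1 e1 1]
    by (simp add: bracket_defs mult_table_def) algebra
  then have a: "a = 0" using assms(2) by simp
  have "6 * (p * (b - 1)^2) = 0" using E[of e2 e2 e1 e2 2] a
    by (simp add: bracket_defs mult_table_def) algebra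
  then have p: "p = 0" using assms(2) by simp
  have "(b - 1) * (b * q) = 0" using E[of e1 e1 e2 e2 2] a p
    by (simp add: bracket_defs mult_table_def) algebra
  moreover have "(b - 1) * ((2 * b - 3) * q) = 0" using E[of e1 e2 e1 e2 2] a p
    by (simp add: bracket_defs mult_table_def) algebra
  ultimately have q: "q = 0" using assms(2) by auto
  show ?thesis
  proof (cases "b = 2")
    case True
    \<comment> \<open>At \<open>b = 2\<close> the branches 2b + d = 3 and b + d = 1 meet.\<close>
    have "table8 1 0 a b 0 (3 - 2 * b) p q \<cong>\<^sub>a T10 2" unfolding T_table8
      by (rule table8_alg_isoI[of 1 1 0 1, OF _ refl]) (simp_all add: table8_apply a p q True)
    then show ?thesis using classified_T(11) classified_alg_iso by blast
  next
    case False
    then show ?thesis using classified_T(10)[of b] assms(3) a p q by (simp add: T_table8)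
  qed
qed

lemma classified_T10_shape:
  fixes b c p q :: "'k::field_char_0"
  assumes "table8 1 0 0 b c (1 - b) p q \<in> terminal2" "b \<noteq> 1"
  shows "classified (table8 1 0 0 b c (1 - b) p q)"
proof -
  note E = terminal2_eq[OF assms(1)]
  have "2 * ((b - 1) * ((2 * b - 1) * p)) = 0" using E[of e1 e1 e2 e2 1]
    by (simp add: bracket_defs mult_table_def) algebra
  then have 1: "(2 * b - 1) * p = 0" using assms(2) by simp
  have "(b - 1) * ((b - 2) * p) = 0" using E[of e2 e2 e2 e1 2]
    by (simp add: bracket_defs mult_table_def) algebra
  then have 2: "(b - 2) * p = 0" using assms(2) by simp
  \<comment> \<open>The combination (2b - 1) - 2 (b - 2) = 3 is free of \<open>b\<close>.\<close>
  have "3 * p = 0" using 1 2 by algebra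
  then have p: "p = 0" by simp
  have "(b - 1) * (b * c) = 0" using E[of e1 e1 e2 e1 1]
    by (simp add: bracket_defs mult_table_def) algebra
  then have bc: "b * c = 0" using assms(2) by simp
  have "(b - 1) * q = 0" using E[of e2 e1 e1 e2 2] bc
    by (simp add: bracket_defs mult_table_def) algebra
  then have q: "q = 0" using assms(2) by simp
  have "2 * ((b - 1)^2 * c) = 0" using E[of e1 e2 e2 e1 2] q
    by (simp add: bracket_defs mult_table_def) algebra
  then have c: "c = 0" using assms(2) by simp
  have "table8 1 0 0 b c (1 - b) p q \<cong>\<^sub>a T10 b" unfolding T_table8
    by (rule table8_alg_isoI[of 1 1 0 1, OF _ refl]) (simp_all add: table8_apply p q c)
  then show ?thesis using classified_T(11) classified_alg_iso by blast
qed

lemma classified_idempotent: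
  fixes a b c d p q :: "'k::{alg_closed_field, field_char_0}"
  assumes "table8 1 0 a b c d p q \<in> terminal2"
  shows "classified (table8 1 0 a b c d p q)"
proof -
  note sh = table8_shift[of 1 a b c d p q]
  note tm = terminal2_alg_iso[OF sh assms]
  consider "d = 0" | "d \<noteq> 0" "2 * b + d = 3" | "d \<noteq> 0" "b + d = 1"
  proof -
    have "d = 0 \<or> 2 * b + d - 3 = 0 \<or> b + d - 1 = 0"
      using eigenline_idempotent[OF assms] by (simp only: mult_eq_0_iff)
    then show ?thesis using that by auto
  qed
  then show ?thesis
  proof cases
    case 1
    show ?thesis
      by (rule classified_alg_iso[OF sh[of "- c"]])
        (use tm[of "- c"] 1 in \<open>simp add: classified_idempotent_d0\<close>)
  next
    case 2
    have d: "d = 3 - 2 * b" using 2(2) by (simp add: algebra_simps)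
    show ?thesis
    proof (cases "b = 1")
      case True
      then show ?thesis using classified_unital[of a c p q] assms d by simp
    next
      case False
      \<comment> \<open>Here 1 - d = 2 (b - 1) is nonzero, so the shift can clear
        \<open>c\<close>.\<close>
      have c: "c + (- c / (1 - d)) * (1 - d) = 0" and "b \<noteq> 3 / 2"
        using False 2(1) d by (auto simp: mult.commute)
      then show ?thesis
        using classified_alg_iso[OF sh[of "- c / (1 - d)"]] classified_T08_shape[OF _ False] 
          tm[of "- c / (1 - d)"] unfolding c d[symmetric] by blast
    qed
  next
    case 3
    have d: "d = 1 - b" using 3(2) by (simp add: algebra_simps)
    \<comment> \<open>In this branch \<open>a\<close> is cleared, as 1 - b = d is nonzero; clearing
      \<open>c\<close> would divide by 1 - d = b, which may vanish.\<close>
    have a: "a + (- a / d) * d = 0" and "b \<noteq> 1"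
      using 3(1) d by auto
    then show ?thesis
      using classified_alg_iso[OF sh[of "- a / d"]] classified_T10_shape[where b = b, folded d]
        tm[of "- a / d"] unfolding d[symmetric] a by blast
  qed
qed

section \<open>Tables whose first basis vector squares to zero\<close>

lemma classified_nilpotent_d0:
  fixes a b c p q :: "'k::{alg_closed_field, field_char_0}"
  assumes t: "table8 0 0 a b c 0 p q \<in> terminal2" and b: "b \<noteq> 0"
  shows "classified (table8 0 0 a b c 0 p q)"
proof -
  note E = terminal2_eq[OF t]
  have "b^2 * c = 0" using E[of e1 e1 e2 e1 1]
    by (simp add: bracket_defs mult_table_def)
  then have c: "c = 0" using b by simp
  have "b^2 * (a + q) = 0" using E[of e1 e1 e2 e2 2] c
    by (simp add: bracket_defs mult_table_def) algebra
  then have q: "q = - a" using b by (simp add: eq_neg_iff_add_eq_0 add.commute)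
  have "2 * (b * (b * p + a * a)) = 0" using E[of e1 e2 e1 e2 1] c q
    by (simp add: bracket_defs mult_table_def) algebra
  then have p: "b * p = - (a * a)" using b by (simp add: eq_neg_iff_add_eq_0)
  \<comment> \<open>The relations found for \<open>q\<close> and \<open>p\<close> make the shift
    that clears \<open>a\<close> clear them as well.\<close>
  have "table8 0 0 a b c 0 p q \<cong>\<^sub>a table8 0 0 0 b 0 0 0 0"
    using table8_shift[of 0 a b c 0 p q "a / b"] b c q p by (simp add: field_simps)
  moreover have "table8 0 0 0 b 0 0 0 0 \<cong>\<^sub>a T04" unfolding T_table8
    by (rule table8_alg_isoI[of 0 0 1 "1 / b", OF _ refl]) (use b in \<open>simp_all add: table8_apply\<close>)
  ultimately show ?thesis using classified_T(4) classified_alg_iso by blast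
qed

lemma classified_nilpotent_d:
  fixes a b d p q :: "'k::{alg_closed_field, field_char_0}"
  assumes t: "table8 0 0 a b 0 d p q \<in> terminal2" and d: "d \<noteq> 0"
  shows "classified (table8 0 0 a b 0 d p q)"
proof -
  note E = terminal2_eq[OF t]
  have bd: "2 * b + d = 0 \<or> b + d = 0" using eigenline_nilpotent[OF t] d by simp
  then have b: "b \<noteq> 0" using d by auto
  have "a * d^2 = 0" using E[of e1 e2 e1 e1 1]
    by (simp add: bracket_defs mult_table_def) algebra
  then have a: "a = 0" using d by simp
  have "2 * (b * d * p) = 0" using E[of e2 e2 e1 e1 1] a
    by (simp add: bracket_defs mult_table_def) algebra
  then have p: "p = 0" using b d by simp
  have "2 * (b * d * q) = 0" using E[of e2 e2 e1 e1 2] a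
    by (simp add: bracket_defs mult_table_def) algebra
  then have q: "q = 0" using b d by simp
  from bd show ?thesis
  proof
    assume "b + d = 0"
    then have d': "d = - b" by (simp add: eq_neg_iff_add_eq_0 add.commute)
    have "table8 0 0 a b 0 d p q \<cong>\<^sub>a T06" unfolding T_table8
      by (rule table8_alg_isoI[of "1 / b" 1 0 0, OF _ refl])
        (use b in \<open>simp_all add: table8_apply a p q d'\<close>)
    then show ?thesis using classified_T(6) classified_alg_iso by blast
  next
    assume "2 * b + d = 0"
    then have d': "d = - (2 * b)" by (simp add: eq_neg_iff_add_eq_0 add.commute)
    have "table8 0 0 a b 0 d p q \<cong>\<^sub>a T05" unfolding T_table8
      by (rule table8_alg_isoI[of 0 0 1 "2 / d", OF _ refl])
        (use b in \<open>simp_all add: table8_apply a p q d'\<close>)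
    then show ?thesis using classified_T(5) classified_alg_iso by blast
  qed
qed

text \<open>Now \<open>e1\<close> spans an ideal with zero product, on which \<open>e2\<close> acts
  by \<open>c\<close> from the left and \<open>a\<close> from the right, while e2 e2 is q e2 modulo
  this ideal. A shift changes \<open>p\<close> by a multiple of a + c - q, so \<open>p\<close> can
  obstruct only when a + c = q. For nonzero \<open>q\<close> this resonance produces
  \<open>T01\<close> and \<open>T02\<close>.\<close>

lemma classified_nilpotent_bd0:
  fixes a c p q :: "'k::{alg_closed_field, field_char_0}"
  assumes t: "table8 0 0 a 0 c 0 p q \<in> terminal2"
  shows "classified (table8 0 0 a 0 c 0 p q)"
proof -
  note E = terminal2_eq[OF t]
  have 1: "a * p * (a + 2 * c - 3 * q) = 0" using E[of e2 e2 e2 e2 1]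
    by (simp add: bracket_defs mult_table_def) algebra
  have 2: "a * (a + c - q) * (a + 2 * c - 3 * q) = 0" using E[of e1 e2 e2 e2 1]
    by (simp add: bracket_defs mult_table_def) algebra
  have kill: "table8 0 0 a 0 c 0 p q \<cong>\<^sub>a table8 0 0 a 0 c 0 0 q" if "p = 0 \<or> a + c \<noteq> q"
  proof (cases "p = 0")
    case True
    then show ?thesis by (simp add: alg_iso_refl)
  next
    case False
    define s where "s = - p / (a + c - q)"
    have "s * (a + c - q) = - p" using False that by (simp add: s_def)
    then have "p + s * (a + c) - s * q = 0" by algebra
    then show ?thesis using table8_shift[of 0 a 0 c 0 p q s] by simp
  qed
  consider "q \<noteq> 0" "p = 0 \<or> a + c \<noteq> q" | "q \<noteq> 0" "p \<noteq> 0" "a + c = q" | "q = 0" by blast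
  then show ?thesis
  proof cases
    case 1
    \<comment> \<open>Once \<open>p\<close> is cleared, e2/q is idempotent and the earlier
      classification applies.\<close>
    have "table8 0 0 a 0 c 0 0 q \<cong>\<^sub>a table8 1 0 0 (c / q) 0 (a / q) 0 0"
      by (rule table8_alg_isoI[of 0 0 "1 / q" 1, OF _ refl]) (use 1(1) in \<open>simp_all add: table8_apply\<close>)
    then have i: "table8 0 0 a 0 c 0 p q \<cong>\<^sub>a table8 1 0 0 (c / q) 0 (a / q) 0 0"
      using kill[OF 1(2)] alg_iso_trans by blast
    show ?thesis
      by (rule classified_alg_iso[OF i classified_idempotent[OF terminal2_alg_iso[OF i t]]])
  next
    case 2
    have c: "c = q - a" using 2(3) by (simp add: algebra_simps)
    have "a * (a + q) = 0" using \<open>a * p * (a + 2 * c - 3 * q) = 0\<close> 2(2) unfolding c by algebra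
    then have "a = 0 \<or> a = - q" by (simp add: eq_neg_iff_add_eq_0)
    then show ?thesis
    proof
      assume a: "a = 0"
      have "table8 0 0 a 0 c 0 p q \<cong>\<^sub>a T01" unfolding T_table8
        by (rule table8_alg_isoI[of 0 0 "1 / q" "p / q^2", OF _ refl])
          (use 2 in \<open>simp_all add: table8_apply a c power2_eq_square\<close>)
      then show ?thesis using classified_T(1) classified_alg_iso by blast
    next
      assume a: "a = - q"
      have "table8 0 0 a 0 c 0 p q \<cong>\<^sub>a T02" unfolding T_table8
        by (rule table8_alg_isoI[of 0 0 "1 / q" "p / q^2", OF _ refl])
          (use 2 in \<open>simp_all add: table8_apply a c power2_eq_square mult.commute\<close>)
      then show ?thesis using classified_T(2) classified_alg_iso by blast
    qed
  next
    case q: 3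
    consider "a = 0" "c = 0" "p = 0" | "a = 0" "c = 0" "p \<noteq> 0" | "a = 0" "c \<noteq> 0"
      | "c \<noteq> 0" "a = - (2 * c)" | "a \<noteq> 0" "c = - a" "p = 0"
    proof (cases "a = 0")
      case True
      then show ?thesis using that by blast
    next
      case False
      have p: "p * (a + 2 * c) = 0" and ac: "(a + c) * (a + 2 * c) = 0"
        using 1 2 q False by (simp_all add: mult.assoc)
      show ?thesis
      proof (cases "a + 2 * c = 0")
        case True
        then have "a = - (2 * c)" by (simp add: eq_neg_iff_add_eq_0)
        then show ?thesis using that(4) False by auto
      next
        case n: False
        have "p = 0" "c + a = 0" using p ac n by (simp_all add: add.commute)
        then show ?thesis using that(5) False by (simp add: eq_neg_iff_add_eq_0)
      qed
    qed
    then show ?thesis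
    proof cases
      case 1
      then show ?thesis using classified_T(8) q by (simp add: T_table8)
    next
      case 2
      have "table8 0 0 a 0 c 0 p q \<cong>\<^sub>a T03" unfolding T_table8
        by (rule table8_alg_isoI[of 0 0 1 p, OF _ refl]) (use 2 q in \<open>simp_all add: table8_apply\<close>)
      then show ?thesis using classified_T(3) classified_alg_iso by blast
    next
      case 3
      have "table8 0 0 a 0 c 0 0 q \<cong>\<^sub>a T04" unfolding T_table8
        by (rule table8_alg_isoI[of 1 "1 / c" 0 0, OF _ refl]) (use 3 q in \<open>simp_all add: table8_apply\<close>)
      moreover have "a + c \<noteq> q" using 3 q by simp
      ultimately show ?thesis using classified_T(4) classified_alg_iso kill by blast
    next
      case 4
      have "table8 0 0 a 0 c 0 0 q \<cong>\<^sub>a T05" unfolding T_table8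
        by (rule table8_alg_isoI[of 1 "2 / a" 0 0, OF _ refl]) (use 4 q in \<open>simp_all add: table8_apply\<close>)
      moreover have "a + c \<noteq> q" using 4 q by simp
      ultimately show ?thesis using classified_T(5) classified_alg_iso kill by blast
    next
      case 5
      \<comment> \<open>Here a + c = q, so no shift could clear \<open>p\<close>; the terminal
        identity has already made it zero.\<close>
      have "table8 0 0 a 0 c 0 p q \<cong>\<^sub>a T06" unfolding T_table8
        by (rule table8_alg_isoI[of 0 0 "1 / c" 1, OF _ refl]) (use 5 q in \<open>simp_all add: table8_apply\<close>)
      then show ?thesis using classified_T(6) classified_alg_iso by blast
    qed
  qed
qed

lemma classified_nilpotent:
  fixes a b c d p q :: "'k::{alg_closed_field, field_char_0}"
  assumes t: "table8 0 0 a b c d p q \<in> terminal2"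
  shows "classified (table8 0 0 a b c d p q)"
proof (cases "d = 0")
  case True
  then show ?thesis using t classified_nilpotent_d0 classified_nilpotent_bd0 by (cases "b = 0") auto
next
  case False
  note sh = table8_shift[of 0 a b c d p q "c / d"]
  have c: "c + c / d * (0 - d) = 0" using False by simp
  show ?thesis
    using classified_alg_iso[OF sh] classified_nilpotent_d[OF _ False] terminal2_alg_iso[OF sh t]
    unfolding c by blast
qed

section \<open>Reduction of a terminal multiplication to these tables\<close>

lemma exists_eigenline:
  fixes \<mu> :: "'k::alg_closed_field mult2"
  assumes "\<mu> \<in> mults2"
  shows "\<exists>x. x \<noteq> 0 \<and> wedge x (\<mu> x x) = 0"
proof -
  obtain a b c d where \<mu>: "\<mu> = mult_table a b c d" using mults2_expand[OF assms] by blast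
  show ?thesis
  proof (cases "d$1 = 0")
    case True
    have "e2 \<noteq> (0 :: 'k^2)" by (simp add: vec2_eq_iff)
    then show ?thesis using True by (intro exI[of _ e2]) (simp add: \<mu> wedge_def)
  next
    case False
    \<comment> \<open>This is the cubic on vectors (1, t). Its leading coefficient is the value at
      \<open>e2\<close>, the one line missed by this chart, which was treated separately.\<close>
    define f where "f = [:- a$2, a$1 - b$2 - c$2, b$1 + c$1 - d$2, d$1:]"
    have "\<exists>t. poly f t = 0" by (rule alg_closed_imp_poly_has_root) (simp add: f_def False)
    then obtain t where "poly f t = 0" ..
    then have "wedge (vec2 1 t) (\<mu> (vec2 1 t) (vec2 1 t)) = 0"
      by (simp add: f_def \<mu> mult_table_def wedge_def algebra_simps)
    moreover have "vec2 1 t \<noteq> 0" by (simp add: vec2_eq_iff)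
    ultimately show ?thesis by blast
  qed
qed

lemma alg_iso_eigenline:
  assumes "\<mu> \<in> mults2" "wedge u v \<noteq> 0" "\<mu> u u = \<epsilon> *s u"
  shows "\<exists>a b c d p q. \<mu> \<cong>\<^sub>a table8 \<epsilon> 0 a b c d p q"
proof -
  have c: "x = vec2 (wedge x v / wedge u v) (wedge u x / wedge u v) $ 1 *s u +
      vec2 (wedge x v / wedge u v) (wedge u x / wedge u v) $ 2 *s v" for x
    using wedge_ne_0_coords[OF assms(2)] by simp
  have "\<mu> u u = vec2 \<epsilon> 0 $ 1 *s u + vec2 \<epsilon> 0 $ 2 *s v" by (simp add: assms(3))
  from alg_iso_tableI[OF assms(1,2) this c c c] show ?thesis by blast
qed

lemma terminal2_classified:
  fixes \<mu> :: "'k::{alg_closed_field, field_char_0} mult2"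
  assumes t: "\<mu> \<in> terminal2"
  shows "classified \<mu>"
proof -
  have m: "\<mu> \<in> mults2" using t by (simp add: terminal2_def)
  obtain x where x: "x \<noteq> 0" "wedge x (\<mu> x x) = 0" using exists_eigenline[OF m] by blast
  obtain v where v: "wedge x v \<noteq> 0"
  proof (cases "x$1 = 0")
    case True
    then show ?thesis using x(1) that[of e1] by (auto simp: wedge_def vec2_eq_iff)
  next
    case False
    then show ?thesis using that[of e2] by (simp add: wedge_def)
  qed
  define k where "k = wedge (\<mu> x x) v / wedge x v"
  have k: "\<mu> x x = k *s x" using wedge_ne_0_coords[OF v, of "\<mu> x x"] x(2) by (simp add: k_def)
  have "\<exists>\<epsilon> a b c d p q. (\<epsilon> = 0 \<or> \<epsilon> = 1) \<and> \<mu> \<cong>\<^sub>a table8 \<epsilon> 0 a b c d p q"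
  proof (cases "k = 0")
    case True
    then have "\<mu> x x = 0 *s x" using k by simp
    from alg_iso_eigenline[OF m v this] show ?thesis by blast
  next
    case False
    define u where "u = (1 / k) *s x"
    have "\<mu> u u = 1 *s u" "wedge u v \<noteq> 0"
      using False v by (simp_all add: u_def mults2_simps[OF m] k) (auto simp: wedge_def field_simps)
    then show ?thesis using alg_iso_eigenline[OF m, of u v 1] by blast
  qed
  then obtain \<epsilon> a b c d p q where \<epsilon>: "\<epsilon> = 0 \<or> \<epsilon> = 1"
    and i: "\<mu> \<cong>\<^sub>a table8 \<epsilon> 0 a b c d p q" by blast
  have "classified (table8 \<epsilon> 0 a b c d p q)"
    using \<epsilon> terminal2_alg_iso[OF i t] classified_idempotent classified_nilpotent by blast
  then show ?thesis using i classified_alg_iso by blast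
qed

section \<open>The degenerations\<close>

lemma degenerates_refl: "\<mu> \<in> terminal2 \<Longrightarrow> degenerates \<mu> \<mu>"
proof -
  assume t: "\<mu> \<in> terminal2"
  then have m: "\<mu> \<in> mults2" by (simp add: terminal2_def)
  have "\<mu> \<in> orbit \<mu>" by (simp add: orbit_eq alg_iso_refl)
  then show ?thesis using t m by (simp add: degenerates_def in_closure_orbit_iff[OF m])
qed

lemma degenerates_of_alg_iso: "\<mu> \<cong>\<^sub>a \<nu> \<Longrightarrow> \<mu> \<in> terminal2 \<Longrightarrow> degenerates \<nu> \<mu>"
  using degenerates_alg_iso[OF degenerates_refl _ alg_iso_refl] by blast

lemma degenerates_curve:
  fixes \<mu> :: "'k::field_char_0 mult2" and a1 a2 b1 b2 c1 c2 d1 d2 :: "'k poly"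
  assumes "\<mu> \<in> terminal2" "\<And>t. t \<noteq> 0 \<Longrightarrow> \<mu> \<cong>\<^sub>a table8 (poly a1 t) (poly a2 t)
      (poly b1 t) (poly b2 t) (poly c1 t) (poly c2 t) (poly d1 t) (poly d2 t)"
    and "\<nu> = table8 (poly a1 0) (poly a2 0) (poly b1 0) (poly b2 0)
      (poly c1 0) (poly c2 0) (poly d1 0) (poly d2 0)" "\<nu> \<in> terminal2"
  shows "degenerates \<mu> \<nu>"
proof -
  have v: "(\<chi> i::2. poly (if i = 1 then p else q) t) = vec2 (poly p t) (poly q t)"
    for p q :: "'k poly" and t by (simp add: vec2_eq_iff)
  show ?thesis
    using closure_orbit_curve[of \<mu> "\<lambda>i. if i = 1 then a1 else a2" "\<lambda>i. if i = 1 then b1 else b2"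
        "\<lambda>i. if i = 1 then c1 else c2" "\<lambda>i. if i = 1 then d1 else d2"] assms
    by (simp add: v degenerates_def terminal2_def)
qed

lemma degenerates_T03:
  fixes \<mu> :: "'k::field_char_0 mult2"
  assumes t: "\<mu> \<in> terminal2" and w: "wedge u (\<mu> u u) \<noteq> 0"
  shows "degenerates \<mu> T03"
proof -
  have m: "\<mu> \<in> mults2" using t by (simp add: terminal2_def)
  let ?v = "\<mu> u u"
  obtain b c d :: "'k^2" where tab: "\<mu> u ?v = b$1 *s u + b$2 *s ?v"
    "\<mu> ?v u = c$1 *s u + c$2 *s ?v" "\<mu> ?v ?v = d$1 *s u + d$2 *s ?v"
  proof
    have "x = vec2 (wedge x ?v / wedge u ?v) (wedge u x / wedge u ?v) $ 1 *s u +
      vec2 (wedge x ?v / wedge u ?v) (wedge u x / wedge u ?v) $ 2 *s ?v" for x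
      using wedge_ne_0_coords[OF w] by simp
    note c = this
    show "\<mu> u ?v = vec2 (wedge (\<mu> u ?v) ?v / wedge u ?v) (wedge u (\<mu> u ?v) / wedge u ?v) $ 1 *s u +
      vec2 (wedge (\<mu> u ?v) ?v / wedge u ?v) (wedge u (\<mu> u ?v) / wedge u ?v) $ 2 *s ?v"
      "\<mu> ?v u = vec2 (wedge (\<mu> ?v u) ?v / wedge u ?v) (wedge u (\<mu> ?v u) / wedge u ?v) $ 1 *s u +
      vec2 (wedge (\<mu> ?v u) ?v / wedge u ?v) (wedge u (\<mu> ?v u) / wedge u ?v) $ 2 *s ?v"
      "\<mu> ?v ?v = vec2 (wedge (\<mu> ?v ?v) ?v / wedge u ?v) (wedge u (\<mu> ?v ?v) / wedge u ?v) $ 1 *s u +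
      vec2 (wedge (\<mu> ?v ?v) ?v / wedge u ?v) (wedge u (\<mu> ?v ?v) / wedge u ?v) $ 2 *s ?v"
      by (rule c)+
  qed
  show ?thesis
  \<comment> \<open>The basis vectors have weights 1 and 2 in \<open>t\<close>. A structure constant
    acquires the total weight of its two factors minus that of the target vector, so only the square
    of the first vector keeps a constant term.\<close>
  proof (rule degenerates_curve[of \<mu> "[:0:]" "[:1:]" "[:0, 0, b$1:]" "[:0, b$2:]"
        "[:0, 0, c$1:]" "[:0, c$2:]" "[:0, 0, 0, d$1:]" "[:0, 0, d$2:]"])
    fix t :: 'k assume "t \<noteq> 0"
    then have "wedge (t *s u) ((t * t) *s ?v) \<noteq> 0"
      using w by (auto simp: wedge_def)
    then show "\<mu> \<cong>\<^sub>a table8 (poly [:0:] t) (poly [:1:] t) (poly [:0, 0, b$1:] t) (poly [:0, b$2:] t)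
      (poly [:0, 0, c$1:] t) (poly [:0, c$2:] t) (poly [:0, 0, 0, d$1:] t) (poly [:0, 0, d$2:] t)"
      by (rule alg_iso_tableI[OF m])
        (simp_all add: mults2_simps[OF m] tab, simp_all add: vec2_eq_iff algebra_simps)
  qed (simp_all add: T_table8(3) t terminal2_T[unfolded T_table8])
qed

text \<open>Scaling the whole basis by \<open>t\<close> multiplies every structure constant by
  \<open>t\<close>.\<close>

lemma degenerates_zero_alg:
  fixes \<mu> :: "'k::field_char_0 mult2"
  assumes t: "\<mu> \<in> terminal2"
  shows "degenerates \<mu> zero_alg"
proof -
  have m: "\<mu> \<in> mults2" using t by (simp add: terminal2_def)
  obtain a b c d where \<mu>: "\<mu> = mult_table a b c d" using mults2_expand[OF m] by blast
  show ?thesis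
  proof (rule degenerates_curve[of \<mu> "[:0, a$1:]" "[:0, a$2:]" "[:0, b$1:]" "[:0, b$2:]"
        "[:0, c$1:]" "[:0, c$2:]" "[:0, d$1:]" "[:0, d$2:]"])
    fix t :: 'k assume "t \<noteq> 0"
    then have "wedge (t *s e1) (t *s e2) \<noteq> 0" by (simp add: wedge_def)
    then show "\<mu> \<cong>\<^sub>a table8 (poly [:0, a$1:] t) (poly [:0, a$2:] t) (poly [:0, b$1:] t) (poly [:0, b$2:] t)
      (poly [:0, c$1:] t) (poly [:0, c$2:] t) (poly [:0, d$1:] t) (poly [:0, d$2:] t)"
      by (rule alg_iso_tableI[OF m])
        (simp_all add: mults2_simps[OF m], simp_all add: \<mu> vec2_eq_iff algebra_simps)
  qed (simp_all add: T_table8 t terminal2_T[unfolded T_table8])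
qed

text \<open>The difference e1 - e2 squares to zero. In the basis e1, e1 - e2 the parameters 1 and 2
  give \<open>T01\<close> and \<open>T02\<close> with the \<open>e2\<close>-part of e1 e1
  removed.\<close>

lemma T10_alg_iso: "T10 \<alpha> \<cong>\<^sub>a table8 1 0 0 \<alpha> 0 (1 - \<alpha>) 0 0"
  unfolding T_table8
  by (rule table8_alg_isoI[of 1 "-1" 0 1, OF _ refl]) (simp_all add: table8_apply algebra_simps)

text \<open>Replacing e2 by e2/t multiplies the \<open>e2\<close>-part of e1 e1 by \<open>t\<close>
  and leaves the other products alone.\<close>

lemma degenerates_T10:
  "degenerates T01 (T10 (1 :: 'k::field_char_0))" "degenerates T02 (T10 (2 :: 'k))"
proof -
  have "degenerates T01 (table8 1 0 0 (1::'k) 0 (1 - 1) 0 0)"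
  proof (rule degenerates_curve[of T01 "[:1:]" "[:0, 1:]" "[:0:]" "[:1:]" "[:0:]" "[:0:]" "[:0:]" "[:0:]"])
    show "T01 \<cong>\<^sub>a table8 (poly [:1:] t) (poly [:0, 1:] t) (poly [:0:] t) (poly [:1:] t)
      (poly [:0:] t) (poly [:0:] t) (poly [:0:] t) (poly [:0:] t)" if "t \<noteq> 0" for t :: 'k
      unfolding T_table8
      by (rule table8_alg_isoI[of 1 "1 / t" 0 0, OF _ refl]) (use that in \<open>simp_all add: table8_apply\<close>)
  qed (use terminal2_alg_iso[OF T10_alg_iso terminal2_T(10)[of "1::'k"]] terminal2_T in simp_all)
  then show "degenerates T01 (T10 (1 :: 'k))"
    using degenerates_alg_iso[OF _ alg_iso_refl alg_iso_sym[OF T10_alg_iso]] by blast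
  have "degenerates T02 (table8 1 0 0 (2::'k) 0 (1 - 2) 0 0)"
  proof (rule degenerates_curve[of T02 "[:1:]" "[:0, 1:]" "[:0:]" "[:2:]" "[:0:]" "[:-1:]" "[:0:]" "[:0:]"])
    show "T02 \<cong>\<^sub>a table8 (poly [:1:] t) (poly [:0, 1:] t) (poly [:0:] t) (poly [:2:] t)
      (poly [:0:] t) (poly [:-1:] t) (poly [:0:] t) (poly [:0:] t)" if "t \<noteq> 0" for t :: 'k
      unfolding T_table8
      by (rule table8_alg_isoI[of 1 "1 / t" 0 0, OF _ refl]) (use that in \<open>simp_all add: table8_apply\<close>)
  qed (use terminal2_alg_iso[OF T10_alg_iso terminal2_T(10)[of "2::'k"]] terminal2_T in simp_all)
  then show "degenerates T02 (T10 (2 :: 'k))"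
    using degenerates_alg_iso[OF _ alg_iso_refl alg_iso_sym[OF T10_alg_iso]] by blast
qed

text \<open>Two ways to degenerate k x k: the idempotent e2 is shrunk beside the idempotent e1, or
  beside the unit e1 + e2. The second yields the dual numbers.\<close>

lemma degenerates_T09:
  "degenerates T09 (T07 (0 :: 'k::field_char_0))" "degenerates T09 (T08 (1 :: 'k))"
proof -
  show "degenerates T09 (T07 (0 :: 'k))"
  proof (rule degenerates_curve[of T09 "[:1:]" "[:0:]" "[:0:]" "[:0:]" "[:0:]" "[:0:]" "[:0:]" "[:0, 1:]"])
    show "T09 \<cong>\<^sub>a table8 (poly [:1:] t) (poly [:0:] t) (poly [:0:] t) (poly [:0:] t)
      (poly [:0:] t) (poly [:0:] t) (poly [:0:] t) (poly [:0, 1:] t)" if "t \<noteq> 0" for t :: 'k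
      unfolding T_table8
      by (rule table8_alg_isoI[of 1 t 0 0, OF _ refl]) (use that in \<open>simp_all add: table8_apply\<close>)
  qed (simp_all add: terminal2_T, simp add: T_table8)
  show "degenerates T09 (T08 (1 :: 'k))"
  proof (rule degenerates_curve[of T09 "[:1:]" "[:0:]" "[:0:]" "[:1:]" "[:0:]" "[:1:]" "[:0:]" "[:0, 1:]"])
    show "T09 \<cong>\<^sub>a table8 (poly [:1:] t) (poly [:0:] t) (poly [:0:] t) (poly [:1:] t)
      (poly [:0:] t) (poly [:1:] t) (poly [:0:] t) (poly [:0, 1:] t)" if "t \<noteq> 0" for t :: 'k
      unfolding T_table8
      by (rule table8_alg_isoI[of 1 t 1 0, OF _ refl]) (use that in \<open>simp_all add: table8_apply\<close>)
  qed (simp_all add: terminal2_T, simp add: T_table8)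
qed

lemma degenerates_T_T03:
  fixes \<alpha> :: "'k::field_char_0"
  shows "degenerates (T01 :: 'k mult2) T03" "degenerates (T02 :: 'k mult2) T03"
    "degenerates (T04 :: 'k mult2) T03" "degenerates (T05 :: 'k mult2) T03"
    "\<alpha> \<noteq> 1 \<Longrightarrow> degenerates (T07 \<alpha>) T03" "\<alpha> \<noteq> 2 \<Longrightarrow> degenerates (T08 \<alpha>) T03"
  by (rule degenerates_T03[OF terminal2_T(1), of e1] degenerates_T03[OF terminal2_T(2), of e1]
      degenerates_T03[OF terminal2_T(4), of "e1 + e2"] degenerates_T03[OF terminal2_T(5), of "e1 + e2"]
      degenerates_T03[OF terminal2_T(7), of "e1 + e2"] degenerates_T03[OF terminal2_T(8), of "e1 + e2"],
      simp add: T_defs mult_table_def wedge_def)+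

section \<open>The invariants of the normal forms\<close>

lemma trace_ratio_T:
  "trace_ratio s t T01 \<longleftrightarrow> 2 * t = s" "trace_ratio s t T02 \<longleftrightarrow> 3 * t = (0 :: 'k::field_char_0)"
  "trace_ratio s t T03" "trace_ratio s t T04 \<longleftrightarrow> t = 0" "trace_ratio s t T05 \<longleftrightarrow> t + 2 * s = 0"
  "trace_ratio s t T06 \<longleftrightarrow> t + s = 0" "trace_ratio s t (T07 \<alpha>) \<longleftrightarrow> t * (1 + \<alpha>) = s"
  "trace_ratio s t (T08 \<alpha>) \<longleftrightarrow> t * (1 + \<alpha>) = s * (4 - 2 * \<alpha>)"
  "trace_ratio s t T09 \<longleftrightarrow> t = s" "trace_ratio s t (T10 \<alpha>) \<longleftrightarrow> t * (1 + \<alpha>) = s * (2 - \<alpha>)"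
  "trace_ratio s t zero_alg"
  unfolding T_table8 trace_ratio_mult_table by (simp_all add: algebra_simps; algebra?)+

lemma square_collinear_T:
  "\<not> square_collinear (T01 :: 'k::field_char_0 mult2)" "\<not> square_collinear (T02 :: 'k mult2)"
  "\<not> square_collinear (T03 :: 'k mult2)" "\<not> square_collinear (T04 :: 'k mult2)"
  "\<not> square_collinear (T05 :: 'k mult2)" "square_collinear (T06 :: 'k mult2)"
  "square_collinear (T07 \<alpha>) \<longleftrightarrow> \<alpha> = (1 :: 'k)" "square_collinear (T08 \<alpha>) \<longleftrightarrow> \<alpha> = (2 :: 'k)"
  "\<not> square_collinear (T09 :: 'k mult2)" "square_collinear (T10 (\<alpha> :: 'k))"
  "square_collinear (zero_alg :: 'k mult2)"
  unfolding T_table8 square_collinear_mult_table by (auto simp: algebra_simps)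

lemma left_rank_le_1_T_D:
  fixes \<alpha> :: "'k::field_char_0"
  shows "\<not> left_rank_le_1 (T02 :: 'k mult2)" "\<not> left_rank_le_1 (T05 :: 'k mult2)"
    "\<not> left_rank_le_1 (T06 :: 'k mult2)" "\<not> left_rank_le_1 (T09 :: 'k mult2)"
    "left_rank_le_1 (T08 \<alpha>) \<Longrightarrow> \<alpha> = 3 / 2" "left_rank_le_1 (T10 \<alpha>) \<Longrightarrow> \<alpha> = 1"
  unfolding T_table8
  by (auto dest: left_rank_le_1_mult_tableD(1)[where i = 1 and j = 1]
      left_rank_le_1_mult_tableD(1)[where i = 1 and j = 2]
      left_rank_le_1_mult_tableD(1)[where i = 2 and j = 2] left_rank_le_1_mult_tableD(2,3)
      simp: field_simps)

lemma double_root_T_D: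
  fixes \<alpha> :: "'k::field_char_0"
  shows "\<not> double_root (T01 :: 'k mult2)" "\<not> double_root (T04 :: 'k mult2)"
    "\<not> double_root (T06 :: 'k mult2)" "\<not> double_root (T09 :: 'k mult2)"
    "double_root (T07 \<alpha>) \<Longrightarrow> \<alpha> = 3 / 2" "double_root (T10 \<alpha>) \<Longrightarrow> \<alpha> = 2"
  unfolding T_table8
  by (auto dest: double_root_mult_tableD simp: eq_divide_eq mult.commute)

lemma normal_form_cases:
  fixes \<nu> :: "'k::{alg_closed_field, field_char_0} mult2"
  assumes "\<nu> \<in> terminal2"
  obtains (T01) "\<nu> \<cong>\<^sub>a T01" | (T02) "\<nu> \<cong>\<^sub>a T02" | (T03) "\<nu> \<cong>\<^sub>a T03" | (T04) "\<nu> \<cong>\<^sub>a T04"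
    | (T05) "\<nu> \<cong>\<^sub>a T05" | (T06) "\<nu> \<cong>\<^sub>a T06" | (T07) \<alpha> where "\<alpha> \<noteq> 1" "\<nu> \<cong>\<^sub>a T07 \<alpha>"
    | (T08) \<alpha> where "\<alpha> \<noteq> 2" "\<alpha> \<noteq> 3 / 2" "\<nu> \<cong>\<^sub>a T08 \<alpha>"
    | (T09) "\<nu> \<cong>\<^sub>a T09" | (T10) \<alpha> where "\<nu> \<cong>\<^sub>a T10 \<alpha>" | (zero) "\<nu> \<cong>\<^sub>a zero_alg"
proof -
  obtain A where A: "A \<in> normal_forms" "\<nu> \<cong>\<^sub>a A"
    using terminal2_classified[OF assms] by (auto simp: classified_def)
  then show thesis unfolding normal_forms_def
    by (elim UnE insertE emptyE CollectE exE conjE rangeE) (hypsubst, rule that; assumption)+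
qed

section \<open>Primary degenerations\<close>

text \<open>All multiplication operators of \<open>T03\<close> and \<open>zero_alg\<close> have
  trace zero, so every ratio holds. The pairs 1, 0 and 0, 1 recover the vanishing of the right and
  the left traces.\<close>

lemma degenerates_nilpotentD:
  fixes \<nu> :: "'k::field_char_0 mult2"
  assumes "degenerates T03 \<nu> \<or> degenerates zero_alg \<nu>"
  shows "trace_ratio s t \<nu>"
  using assms degenerates_trace_ratio[OF _ trace_ratio_T(3)] degenerates_trace_ratio[OF _ trace_ratio_T(11)]
  by auto

lemma degenerates_collinearD:
  fixes \<nu> :: "'k::field_char_0 mult2"
  assumes "degenerates T06 \<nu> \<or> degenerates (T10 \<alpha>) \<nu> \<or> degenerates zero_alg \<nu>"
  shows "square_collinear \<nu>"
  using assms degenerates_square_collinear[OF _ square_collinear_T(6)]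
    degenerates_square_collinear[OF _ square_collinear_T(10)]
    degenerates_square_collinear[OF _ square_collinear_T(11)] by auto

text \<open>In \<open>T10\<close> and \<open>T08\<close> the right traces vanish only at 2 and the
  left ones only at -1; in \<open>T07\<close> the right trace at \<open>e1\<close> is 1.\<close>

lemma trace_ratio_T_zero:
  fixes \<alpha> :: "'k::field_char_0"
  shows "\<not> (trace_ratio 1 0 (T10 \<alpha>) \<and> trace_ratio 0 1 (T10 \<alpha>))"
    "\<not> (trace_ratio 1 0 (T08 \<alpha>) \<and> trace_ratio 0 1 (T08 \<alpha>))"
    "\<not> (trace_ratio 1 0 (T07 \<alpha>) \<and> trace_ratio 0 1 (T07 \<alpha>))"
proof -
  have "(2::'k) \<noteq> \<alpha> \<or> 1 + \<alpha> \<noteq> 0" "(4::'k) \<noteq> 2 * \<alpha> \<or> 1 + \<alpha> \<noteq> 0" by auto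
  then show "\<not> (trace_ratio 1 0 (T10 \<alpha>) \<and> trace_ratio 0 1 (T10 \<alpha>))"
    "\<not> (trace_ratio 1 0 (T08 \<alpha>) \<and> trace_ratio 0 1 (T08 \<alpha>))"
    "\<not> (trace_ratio 1 0 (T07 \<alpha>) \<and> trace_ratio 0 1 (T07 \<alpha>))"
    by (auto simp: trace_ratio_T)
qed

section \<open>Algebras in the orbit closure of each normal form\<close>

context
  fixes \<nu> :: "'k::{alg_closed_field, field_char_0} mult2"
begin

lemma degenerates_normal_form_cases:
  assumes "degenerates \<mu> \<nu>"
  obtains (T01) "\<nu> \<cong>\<^sub>a T01" "degenerates \<mu> T01" | (T02) "\<nu> \<cong>\<^sub>a T02" "degenerates \<mu> T02"
    | (T03) "\<nu> \<cong>\<^sub>a T03" | (T04) "\<nu> \<cong>\<^sub>a T04" "degenerates \<mu> T04"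
    | (T05) "\<nu> \<cong>\<^sub>a T05" "degenerates \<mu> T05" | (T06) "\<nu> \<cong>\<^sub>a T06" "degenerates \<mu> T06"
    | (T07) \<alpha> where "\<alpha> \<noteq> 1" "\<nu> \<cong>\<^sub>a T07 \<alpha>" "degenerates \<mu> (T07 \<alpha>)"
    | (T08) \<alpha> where "\<alpha> \<noteq> 2" "\<alpha> \<noteq> 3 / 2" "\<nu> \<cong>\<^sub>a T08 \<alpha>" "degenerates \<mu> (T08 \<alpha>)"
    | (T09) "\<nu> \<cong>\<^sub>a T09" "degenerates \<mu> T09" | (T10) \<alpha> where "\<nu> \<cong>\<^sub>a T10 \<alpha>" "degenerates \<mu> (T10 \<alpha>)"
    | (zero) "\<nu> \<cong>\<^sub>a zero_alg"
proof -
  have "\<nu> \<in> terminal2" using assms by (simp add: degenerates_def)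
  then show thesis
    by (cases rule: normal_form_cases)
      (use degenerates_alg_iso[OF assms alg_iso_refl] that in blast)+
qed

text \<open>Left rank at most one leaves \<open>T07\<close> and \<open>T10 1\<close> among the
  families; ratio 2 : 1 would require the excluded parameter 1 in \<open>T07\<close>.\<close>

lemma degenerates_T01_cases:
  assumes "degenerates T01 \<nu>"
  shows "\<nu> \<cong>\<^sub>a T01 \<or> \<nu> \<cong>\<^sub>a T03 \<or> \<nu> \<cong>\<^sub>a T10 1 \<or> \<nu> \<cong>\<^sub>a zero_alg"
proof -
  have r: "trace_ratio 2 1 \<rho>" "left_rank_le_1 \<rho>" if "degenerates T01 \<rho>" for \<rho> :: "'k mult2"
    using degenerates_trace_ratio[OF that, of 2 1] degenerates_left_rank_le_1[OF that]
    by (simp_all add: trace_ratio_T left_rank_le_1_T)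
  from assms show ?thesis
  proof (cases rule: degenerates_normal_form_cases)
    case (T07 \<alpha>)
    then show ?thesis using r(1)[OF T07(3)] by (simp add: trace_ratio_T)
  next
    case (T08 \<alpha>)
    then show ?thesis using left_rank_le_1_T_D(5)[OF r(2)[OF T08(4)]] by simp
  next
    case (T10 \<alpha>)
    then show ?thesis using left_rank_le_1_T_D(6)[OF r(2)[OF T10(2)]] by simp
  qed (auto dest: r simp: trace_ratio_T left_rank_le_1_T_D)
qed

text \<open>Vanishing right traces exclude \<open>T07\<close> and force the excluded parameter 2 in
  \<open>T08\<close>. The double root rules out \<open>T04\<close> and leaves only parameter 2 in
  \<open>T10\<close>.\<close>

lemma degenerates_T02_cases:
  assumes "degenerates T02 \<nu>"
  shows "\<nu> \<cong>\<^sub>a T02 \<or> \<nu> \<cong>\<^sub>a T03 \<or> \<nu> \<cong>\<^sub>a T10 2 \<or> \<nu> \<cong>\<^sub>a zero_alg"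
proof -
  have r: "trace_ratio 1 0 \<rho>" "double_root \<rho>" if "degenerates T02 \<rho>" for \<rho> :: "'k mult2"
    using degenerates_trace_ratio[OF that, of 1 0] degenerates_double_root[OF that]
    by (simp_all add: trace_ratio_T double_root_T)
  from assms show ?thesis
  proof (cases rule: degenerates_normal_form_cases)
    case (T07 \<alpha>)
    then show ?thesis using r(1)[OF T07(3)] by (simp add: trace_ratio_T)
  next
    case (T08 \<alpha>)
    then show ?thesis using r(1)[OF T08(4)] by (simp add: trace_ratio_T)
  next
    case (T10 \<alpha>)
    then show ?thesis using double_root_T_D(6)[OF r(2)[OF T10(2)]] by simp
  qed (auto dest: r simp: trace_ratio_T double_root_T_D)
qed

lemma degenerates_T04_cases:
  assumes "degenerates T04 \<nu>"
  shows "\<nu> \<cong>\<^sub>a T04 \<or> \<nu> \<cong>\<^sub>a T03 \<or> \<nu> \<cong>\<^sub>a zero_alg"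
proof -
  have r: "trace_ratio 1 0 \<rho>" "left_rank_le_1 \<rho>" if "degenerates T04 \<rho>" for \<rho> :: "'k mult2"
    using degenerates_trace_ratio[OF that, of 1 0] degenerates_left_rank_le_1[OF that]
    by (simp_all add: trace_ratio_T left_rank_le_1_T)
  from assms show ?thesis
  proof (cases rule: degenerates_normal_form_cases)
    case (T07 \<alpha>)
    then show ?thesis using r(1)[OF T07(3)] by (simp add: trace_ratio_T)
  next
    case (T08 \<alpha>)
    then show ?thesis using r(1)[OF T08(4)] by (simp add: trace_ratio_T)
  next
    case (T10 \<alpha>)
    \<comment> \<open>The traces require parameter 2, the left rank requires 1.\<close>
    then show ?thesis using r(1)[OF T10(2)] left_rank_le_1_T_D(6)[OF r(2)[OF T10(2)]]
      by (simp add: trace_ratio_T)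
  qed (auto dest: r simp: trace_ratio_T left_rank_le_1_T_D)
qed

lemma degenerates_T05_cases:
  assumes "degenerates T05 \<nu>"
  shows "\<nu> \<cong>\<^sub>a T05 \<or> \<nu> \<cong>\<^sub>a T03 \<or> \<nu> \<cong>\<^sub>a zero_alg"
proof -
  have r: "trace_ratio (-1) 2 \<rho>" "double_root \<rho>" if "degenerates T05 \<rho>" for \<rho> :: "'k mult2"
    using degenerates_trace_ratio[OF that, of "-1" 2] degenerates_double_root[OF that]
    by (simp_all add: trace_ratio_T double_root_T)
  from assms show ?thesis
  proof (cases rule: degenerates_normal_form_cases)
    case (T07 \<alpha>)
    \<comment> \<open>The traces require parameter -3/2, the double root requires 3/2.\<close>
    then show ?thesis using r(1)[OF T07(3)] double_root_T_D(5)[OF r(2)[OF T07(3)]]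
      by (simp add: trace_ratio_T)
  next
    case (T08 \<alpha>)
    then show ?thesis using r(1)[OF T08(4)] by (simp add: trace_ratio_T algebra_simps)
  next
    case (T10 \<alpha>)
    then show ?thesis using r(1)[OF T10(2)] double_root_T_D(6)[OF r(2)[OF T10(2)]]
      by (simp add: trace_ratio_T)
  qed (auto dest: r simp: trace_ratio_T double_root_T_D)
qed

text \<open>Both \<open>T01\<close> and \<open>T10 1\<close> have left rank one but ratio 2 : 1,
  which this family attains only at its excluded parameter.\<close>

lemma degenerates_T07_cases:
  assumes "degenerates (T07 \<alpha>) \<nu>" "\<alpha> \<noteq> 1"
  shows "\<nu> \<cong>\<^sub>a T07 \<alpha> \<or> \<nu> \<cong>\<^sub>a T03 \<or> \<nu> \<cong>\<^sub>a zero_alg"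
proof -
  have r: "trace_ratio (1 + \<alpha>) 1 \<rho>" "left_rank_le_1 \<rho>" if "degenerates (T07 \<alpha>) \<rho>"
    for \<rho> :: "'k mult2"
    using degenerates_trace_ratio[OF that, of "1 + \<alpha>" 1] degenerates_left_rank_le_1[OF that]
    by (simp_all add: trace_ratio_T left_rank_le_1_T)
  from assms(1) show ?thesis
  proof (cases rule: degenerates_normal_form_cases)
    case T01
    then show ?thesis using r(1)[OF T01(2)] assms(2) by (simp add: trace_ratio_T)
  next
    case (T07 \<beta>)
    then show ?thesis using r(1)[OF T07(3)] by (simp add: trace_ratio_T)
  next
    case (T08 \<beta>)
    then show ?thesis using left_rank_le_1_T_D(5)[OF r(2)[OF T08(4)]] by simp
  next
    case (T10 \<beta>)
    then show ?thesis using r(1)[OF T10(2)] left_rank_le_1_T_D(6)[OF r(2)[OF T10(2)]] assms(2)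
      by (simp add: trace_ratio_T)
  qed (auto dest: r simp: trace_ratio_T left_rank_le_1_T_D)
qed

lemma degenerates_T08_cases:
  assumes "degenerates (T08 \<alpha>) \<nu>" "\<alpha> \<noteq> 2" "\<alpha> \<noteq> 3 / 2"
  shows "\<nu> \<cong>\<^sub>a T08 \<alpha> \<or> \<nu> \<cong>\<^sub>a T03 \<or> \<nu> \<cong>\<^sub>a zero_alg"
proof -
  have r: "trace_ratio (1 + \<alpha>) (4 - 2 * \<alpha>) \<rho>" "double_root \<rho>" if "degenerates (T08 \<alpha>) \<rho>"
    for \<rho> :: "'k mult2"
    using degenerates_trace_ratio[OF that, of "1 + \<alpha>" "4 - 2 * \<alpha>"] degenerates_double_root[OF that]
    by (simp_all add: trace_ratio_T double_root_T mult.commute)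
  from assms(1) show ?thesis
  proof (cases rule: degenerates_normal_form_cases)
    case T02
    then show ?thesis using r(1)[OF T02(2)] assms(2) by (simp add: trace_ratio_T)
  next
    case T05
    have "2 * (3::'k) = 0" using r(1)[OF T05(2)] by (simp add: trace_ratio_T algebra_simps)
    then show ?thesis by simp
  next
    case (T07 \<beta>)
    have "(4 - 2 * \<alpha>) * (1 + \<beta>) = 1 + \<alpha>" using r(1)[OF T07(3)] by (simp only: trace_ratio_T)
    moreover have "\<beta> * 2 = 3" using double_root_T_D(5)[OF r(2)[OF T07(3)]] by simp
    \<comment> \<open>With \<beta> = 3/2 the trace equation returns \<alpha> = 3/2, the excluded
      meeting point of the two families.\<close>
    ultimately have "6 * (\<alpha> * 2 - 3) = 0" by algebra
    then have "\<alpha> * 2 - 3 = 0" by (simp only: mult_eq_0_iff) simp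
    then have "\<alpha> = 3 / 2" by (simp add: eq_divide_eq)
    then show ?thesis using assms(3) by simp
  next
    case (T08 \<beta>)
    have "(4 - 2 * \<alpha>) * (1 + \<beta>) = (1 + \<alpha>) * (4 - 2 * \<beta>)"
      using r(1)[OF T08(4)] by (simp add: trace_ratio_T)
    \<comment> \<open>The trace ratio (1 + \<alpha>) / (4 - 2 \<alpha>) is a Moebius function of
      determinant 6, hence injective.\<close>
    then have "6 * (\<beta> - \<alpha>) = 0" by algebra
    then show ?thesis using T08(3) by simp
  next
    case (T10 \<beta>)
    then show ?thesis using r(1)[OF T10(2)] double_root_T_D(6)[OF r(2)[OF T10(2)]] assms(2)
      by (simp add: trace_ratio_T)
  qed (auto dest: r simp: trace_ratio_T double_root_T_D)
qed

lemma degenerates_T09_cases: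
  assumes "degenerates T09 \<nu>"
  shows "\<nu> \<cong>\<^sub>a T09 \<or> \<nu> \<cong>\<^sub>a T07 0 \<or> \<nu> \<cong>\<^sub>a T08 1 \<or> \<nu> \<cong>\<^sub>a T03 \<or> \<nu> \<cong>\<^sub>a zero_alg"
proof -
  have r: "trace_ratio 1 1 \<rho>" "associative \<rho>" if "degenerates T09 \<rho>" for \<rho> :: "'k mult2"
    using degenerates_trace_ratio[OF that, of 1 1] degenerates_associative[OF that]
    by (simp_all add: trace_ratio_T associative_T09)
  from assms show ?thesis
  proof (cases rule: degenerates_normal_form_cases)
    case (T07 \<alpha>)
    then show ?thesis using r(1)[OF T07(3)] by (simp add: trace_ratio_T)
  next
    case (T08 \<alpha>)
    have "3 * (\<alpha> - 1) = 0" using r(1)[OF T08(4)] by (simp add: trace_ratio_T algebra_simps)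
    then show ?thesis using T08(3) by simp
  next
    case (T10 \<alpha>)
    \<comment> \<open>Traces cannot exclude the commutative member of this family; associativity
      does.\<close>
    have "2 * \<alpha> = 1" using r(1)[OF T10(2)] by (simp add: trace_ratio_T algebra_simps)
    then have "\<alpha> = 1 / 2" by (simp add: eq_divide_eq mult.commute)
    then show ?thesis using r(2)[OF T10(2)] not_associative_T10 by blast
  qed (auto dest: r simp: trace_ratio_T)
qed

lemma degenerates_T10_cases:
  assumes "degenerates (T10 \<alpha>) \<nu>"
  shows "\<nu> \<cong>\<^sub>a T10 \<alpha> \<or> \<nu> \<cong>\<^sub>a zero_alg"
proof -
  have r: "trace_ratio (1 + \<alpha>) (2 - \<alpha>) \<rho>" "square_collinear \<rho>" if "degenerates (T10 \<alpha>) \<rho>"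
    for \<rho> :: "'k mult2"
    using degenerates_trace_ratio[OF that, of "1 + \<alpha>" "2 - \<alpha>"] degenerates_square_collinear[OF that]
    by (simp_all add: trace_ratio_T square_collinear_T mult.commute)
  \<comment> \<open>The \<open>T03\<close> case of the case rule carries no degeneration, so it is
    refuted through the invariant of \<open>\<nu>\<close> itself.\<close>
  have "\<nu> \<cong>\<^sub>a T03 \<Longrightarrow> square_collinear (T03 :: 'k mult2)"
    using r(2)[OF assms] square_collinear_alg_iso by blast
  from assms this show ?thesis
  proof (cases rule: degenerates_normal_form_cases)
    case T06
    then show ?thesis using r(1)[OF T06(2)] by (simp add: trace_ratio_T)
  next
    case (T10 \<beta>)
    have "(2 - \<alpha>) * (1 + \<beta>) = (1 + \<alpha>) * (2 - \<beta>)"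
      using r(1)[OF T10(2)] by (simp add: trace_ratio_T)
    \<comment> \<open>Here the ratio (1 + \<alpha>) / (2 - \<alpha>) has determinant 3.\<close>
    then have "3 * (\<beta> - \<alpha>) = 0" by algebra
    then show ?thesis using T10(1) by simp
  qed (auto dest: r simp: square_collinear_T)
qed

lemma degenerates_T06_cases:
  assumes "degenerates T06 \<nu>"
  shows "\<nu> \<cong>\<^sub>a T06 \<or> \<nu> \<cong>\<^sub>a zero_alg"
proof -
  have r: "trace_ratio (-1) 1 \<rho>" "square_collinear \<rho>" if "degenerates T06 \<rho>"
    for \<rho> :: "'k mult2"
    using degenerates_trace_ratio[OF that, of "-1" 1] degenerates_square_collinear[OF that]
    by (simp_all add: trace_ratio_T square_collinear_T)
  have "\<nu> \<cong>\<^sub>a T03 \<Longrightarrow> square_collinear (T03 :: 'k mult2)"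
    using r(2)[OF assms] square_collinear_alg_iso by blast
  from assms this show ?thesis
  proof (cases rule: degenerates_normal_form_cases)
    case (T10 \<beta>)
    have "(3::'k) = 0" using r(1)[OF T10(2)] by (simp add: trace_ratio_T)
    then show ?thesis by simp
  qed (auto dest: r simp: square_collinear_T)
qed

lemma degenerates_T03_cases:
  assumes "degenerates T03 \<nu>"
  shows "\<nu> \<cong>\<^sub>a T03 \<or> \<nu> \<cong>\<^sub>a zero_alg"
proof -
  have r: "trace_ratio s t \<rho>" if "degenerates T03 \<rho>" for s t and \<rho> :: "'k mult2"
    using degenerates_nilpotentD that by blast
  from assms show ?thesis
    by (cases rule: degenerates_normal_form_cases)
      (use r[where s = 1 and t = 0] r[where s = 0 and t = 1] trace_ratio_T_zero in
        \<open>force simp: trace_ratio_T(1,2,4,5,6,9)\<close>)+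
qed

lemma degenerates_zero_alg_cases:
  assumes "degenerates zero_alg \<nu>"
  shows "\<nu> \<cong>\<^sub>a zero_alg"
proof -
  have r: "trace_ratio s t \<rho>" if "degenerates zero_alg \<rho>" for s t and \<rho> :: "'k mult2"
    using degenerates_nilpotentD that by blast
  have "\<nu> \<cong>\<^sub>a T03 \<Longrightarrow> square_collinear (T03 :: 'k mult2)"
    using degenerates_collinearD assms square_collinear_alg_iso by blast
  from assms this show ?thesis
    by (cases rule: degenerates_normal_form_cases)
      (use r[where s = 1 and t = 0] r[where s = 0 and t = 1] trace_ratio_T_zero in
        \<open>force simp: trace_ratio_T(1,2,4,5,6,9) square_collinear_T\<close>)+
qed

end

text \<open>\<open>M\<close> holds the algebras directly below \<open>A\<close>, \<open>N\<close>
  the remaining ones. Each member of \<open>N\<close> has a member of \<open>M\<close> between it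
  and \<open>A\<close>. Nothing fits between \<open>A\<close> and a member of \<open>M\<close>,
  because \<open>M\<close> is an antichain and no member of \<open>N\<close> degenerates to one of
  \<open>M\<close>.\<close>

lemma primary_degeneration_iff:
  fixes A :: "'k::field mult2"
  assumes A: "A \<in> terminal2" and closure: "\<And>\<nu>. degenerates A \<nu> \<Longrightarrow> \<nu> \<cong>\<^sub>a A \<or> (\<exists>B\<in>M \<union> N. \<nu> \<cong>\<^sub>a B)"
    and M: "\<And>B. B \<in> M \<Longrightarrow> degenerates A B" "\<And>B. B \<in> M \<Longrightarrow> \<not> degenerates B A"
    and N: "\<And>C. C \<in> N \<Longrightarrow> \<exists>B\<in>M. degenerates B C"
      "\<And>B C. B \<in> M \<Longrightarrow> C \<in> N \<Longrightarrow> \<not> degenerates C B"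
    and antichain: "\<And>B C. B \<in> M \<Longrightarrow> C \<in> M \<Longrightarrow> B \<noteq> C \<Longrightarrow> \<not> degenerates C B"
  shows "primary_degeneration A \<nu> \<longleftrightarrow> (\<exists>B\<in>M. \<nu> \<cong>\<^sub>a B)"
proof
  assume p: "primary_degeneration A \<nu>"
  then have deg: "degenerates A \<nu>" and ne: "\<not> A \<cong>\<^sub>a \<nu>"
    by (auto simp: primary_degeneration_def proper_degeneration_def)
  have "\<not> \<nu> \<cong>\<^sub>a C" if C: "C \<in> N" for C
  proof
    assume i: "\<nu> \<cong>\<^sub>a C"
    obtain B where B: "B \<in> M" "degenerates B C" using N(1)[OF C] by blast
    have "degenerates B \<nu>" using degenerates_alg_iso[OF B(2) alg_iso_refl alg_iso_sym[OF i]] .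
    moreover have "\<not> B \<cong>\<^sub>a A" using M(2)[OF B(1)] degenerates_of_alg_iso alg_iso_sym A by blast
    moreover have "\<not> B \<cong>\<^sub>a \<nu>"
    proof
      assume "B \<cong>\<^sub>a \<nu>"
      then have "B \<cong>\<^sub>a C" using i alg_iso_trans by blast
      then have "degenerates C B" using degenerates_of_alg_iso B(2) by (auto simp: degenerates_def)
      then show False using N(2)[OF B(1) C] by blast
    qed
    ultimately show False using p M(1)[OF B(1)] unfolding primary_degeneration_def by blast
  qed
  then show "\<exists>B\<in>M. \<nu> \<cong>\<^sub>a B" using closure[OF deg] ne alg_iso_sym by blast
next
  assume "\<exists>B\<in>M. \<nu> \<cong>\<^sub>a B"
  then obtain B where B: "B \<in> M" "\<nu> \<cong>\<^sub>a B" by blast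
  have "degenerates A \<nu>" using degenerates_alg_iso[OF M(1)[OF B(1)] alg_iso_refl alg_iso_sym[OF B(2)]] .
  moreover have "\<not> A \<cong>\<^sub>a \<nu>"
    using M(2)[OF B(1)] degenerates_of_alg_iso[OF _ A] alg_iso_trans[OF _ B(2)] by blast
  moreover have False
    if \<rho>: "\<not> \<rho> \<cong>\<^sub>a A" "\<not> \<rho> \<cong>\<^sub>a \<nu>" "degenerates A \<rho>" "degenerates \<rho> \<nu>" for \<rho>
  proof -
    obtain C where C: "C \<in> M \<union> N" "\<rho> \<cong>\<^sub>a C" using closure[OF \<rho>(3)] \<rho>(1) by blast
    have "degenerates C B" using degenerates_alg_iso[OF \<rho>(4) C(2) B(2)] .
    then have "C = B" using antichain[OF B(1)] N(2)[OF B(1)] C(1) by blast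
    then show False using \<rho>(2) C(2) B(2) alg_iso_trans alg_iso_sym by blast
  qed
  ultimately show "primary_degeneration A \<nu>"
    unfolding primary_degeneration_def proper_degeneration_def by blast
qed

lemma not_degenerates_zero_alg:
  fixes \<alpha> :: "'k::field_char_0"
  shows "\<not> degenerates zero_alg (T03 :: 'k mult2)" "\<not> degenerates zero_alg (T10 \<alpha>)"
    "\<not> degenerates zero_alg (T06 :: 'k mult2)" "\<not> degenerates zero_alg (T07 (0::'k))"
    "\<not> degenerates zero_alg (T08 (1::'k))"
  using degenerates_collinearD[of T03] degenerates_nilpotentD[of "T10 \<alpha>"]
    degenerates_nilpotentD[of "T06 :: 'k mult2" 1 0] degenerates_nilpotentD[of "T07 (0::'k)" 1 0]
    degenerates_nilpotentD[of "T08 (1::'k)" 1 0] trace_ratio_T_zero(1)[of \<alpha>]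
  by (auto simp: trace_ratio_T(6,7,8) square_collinear_T)

lemma not_degenerates_T03:
  fixes \<alpha> :: "'k::field_char_0"
  shows "\<not> degenerates T03 (T01 :: 'k mult2)" "\<not> degenerates T03 (T02 :: 'k mult2)"
    "\<not> degenerates T03 (T04 :: 'k mult2)" "\<not> degenerates T03 (T05 :: 'k mult2)"
    "\<not> degenerates T03 (T07 \<alpha>)" "\<not> degenerates T03 (T08 \<alpha>)" "\<not> degenerates T03 (T10 \<alpha>)"
    "\<not> degenerates T03 (T09 :: 'k mult2)"
  using degenerates_nilpotentD[of "T01 :: 'k mult2" 1 0] degenerates_nilpotentD[of "T02 :: 'k mult2" 0 1]
    degenerates_nilpotentD[of "T04 :: 'k mult2" 0 1] degenerates_nilpotentD[of "T05 :: 'k mult2" 1 0]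
    degenerates_nilpotentD[of "T09 :: 'k mult2" 1 0]
    degenerates_nilpotentD[of "T07 \<alpha>"] degenerates_nilpotentD[of "T08 \<alpha>"] degenerates_nilpotentD[of "T10 \<alpha>"]
    trace_ratio_T_zero[of \<alpha>]
  by (auto simp: trace_ratio_T(1,2,4,5,9))

lemma not_degenerates_T10:
  fixes \<alpha> :: "'k::field_char_0"
  shows "\<not> degenerates (T10 \<alpha>) T01" "\<not> degenerates (T10 \<alpha>) T02" "\<not> degenerates (T10 \<alpha>) T03"
  using degenerates_collinearD square_collinear_T(1,2,3) by blast+

text \<open>All three algebras have trace ratio 1 : 1, so left rank and double root must separate
  them.\<close>

lemma not_degenerates_T07_T08:
  "\<not> degenerates (T07 (0::'k::field_char_0)) T09" "\<not> degenerates (T08 (1::'k)) T09"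
  "\<not> degenerates (T07 (0::'k)) (T08 1)" "\<not> degenerates (T08 (1::'k)) (T07 0)"
  using degenerates_left_rank_le_1[OF _ left_rank_le_1_T(3)] degenerates_double_root[OF _ double_root_T(3)]
    left_rank_le_1_T_D(4) left_rank_le_1_T_D(5)[of "1::'k"] double_root_T_D(4) double_root_T_D(5)[of "0::'k"]
  by (auto simp: field_simps)

lemmas degeneration_facts = terminal2_T[THEN degenerates_zero_alg] degenerates_T_T03 degenerates_T10
  degenerates_T09 not_degenerates_zero_alg not_degenerates_T03 not_degenerates_T10
  not_degenerates_T07_T08

section \<open>Primary degenerations of each normal form\<close>

context
  fixes \<nu> :: "'k::{alg_closed_field, field_char_0} mult2" and \<alpha> :: 'k
begin

lemma primary_T01:
  "primary_degeneration T01 \<nu> \<longleftrightarrow> \<nu> \<cong>\<^sub>a T03 \<or> \<nu> \<cong>\<^sub>a T10 1"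
proof -
  have "primary_degeneration T01 \<nu> \<longleftrightarrow> (\<exists>B\<in>{T03, T10 1}. \<nu> \<cong>\<^sub>a B)"
    by (rule primary_degeneration_iff[OF terminal2_T(1), where N = "{zero_alg}"])
      (use degenerates_T01_cases in \<open>auto simp: degeneration_facts\<close>)
  then show ?thesis by simp
qed

lemma primary_T02:
  "primary_degeneration T02 \<nu> \<longleftrightarrow> \<nu> \<cong>\<^sub>a T03 \<or> \<nu> \<cong>\<^sub>a T10 2"
proof -
  have "primary_degeneration T02 \<nu> \<longleftrightarrow> (\<exists>B\<in>{T03, T10 2}. \<nu> \<cong>\<^sub>a B)"
    by (rule primary_degeneration_iff[OF terminal2_T(2), where N = "{zero_alg}"])
      (use degenerates_T02_cases in \<open>auto simp: degeneration_facts\<close>)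
  then show ?thesis by simp
qed

lemma primary_T03:
  "primary_degeneration T03 \<nu> \<longleftrightarrow> \<nu> \<cong>\<^sub>a zero_alg"
proof -
  have "primary_degeneration T03 \<nu> \<longleftrightarrow> (\<exists>B\<in>{zero_alg}. \<nu> \<cong>\<^sub>a B)"
    by (rule primary_degeneration_iff[OF terminal2_T(3), where N = "{}"])
      (use degenerates_T03_cases in \<open>auto simp: degeneration_facts\<close>)
  then show ?thesis by simp
qed

lemma primary_T04:
  "primary_degeneration T04 \<nu> \<longleftrightarrow> \<nu> \<cong>\<^sub>a T03"
proof -
  have "primary_degeneration T04 \<nu> \<longleftrightarrow> (\<exists>B\<in>{T03}. \<nu> \<cong>\<^sub>a B)"
    by (rule primary_degeneration_iff[OF terminal2_T(4), where N = "{zero_alg}"])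
      (use degenerates_T04_cases in \<open>auto simp: degeneration_facts\<close>)
  then show ?thesis by simp
qed

lemma primary_T05:
  "primary_degeneration T05 \<nu> \<longleftrightarrow> \<nu> \<cong>\<^sub>a T03"
proof -
  have "primary_degeneration T05 \<nu> \<longleftrightarrow> (\<exists>B\<in>{T03}. \<nu> \<cong>\<^sub>a B)"
    by (rule primary_degeneration_iff[OF terminal2_T(5), where N = "{zero_alg}"])
      (use degenerates_T05_cases in \<open>auto simp: degeneration_facts\<close>)
  then show ?thesis by simp
qed

lemma primary_T06:
  "primary_degeneration T06 \<nu> \<longleftrightarrow> \<nu> \<cong>\<^sub>a zero_alg"
proof -
  have "primary_degeneration T06 \<nu> \<longleftrightarrow> (\<exists>B\<in>{zero_alg}. \<nu> \<cong>\<^sub>a B)"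
    by (rule primary_degeneration_iff[OF terminal2_T(6), where N = "{}"])
      (use degenerates_T06_cases in \<open>auto simp: degeneration_facts\<close>)
  then show ?thesis by simp
qed

lemma primary_T07:
  assumes a: "\<alpha> \<noteq> 1"
  shows "primary_degeneration (T07 \<alpha>) \<nu> \<longleftrightarrow> \<nu> \<cong>\<^sub>a T03"
proof -
  have "primary_degeneration (T07 \<alpha>) \<nu> \<longleftrightarrow> (\<exists>B\<in>{T03}. \<nu> \<cong>\<^sub>a B)"
    by (rule primary_degeneration_iff[OF terminal2_T(7), where N = "{zero_alg}"])
      (use degenerates_T07_cases a in \<open>auto simp: degeneration_facts\<close>)
  then show ?thesis by simp
qed

lemma primary_T08:
  assumes a: "\<alpha> \<noteq> 2" "\<alpha> \<noteq> 3 / 2"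
  shows "primary_degeneration (T08 \<alpha>) \<nu> \<longleftrightarrow> \<nu> \<cong>\<^sub>a T03"
proof -
  have "primary_degeneration (T08 \<alpha>) \<nu> \<longleftrightarrow> (\<exists>B\<in>{T03}. \<nu> \<cong>\<^sub>a B)"
    by (rule primary_degeneration_iff[OF terminal2_T(8), where N = "{zero_alg}"])
      (use degenerates_T08_cases a in \<open>auto simp: degeneration_facts\<close>)
  then show ?thesis by simp
qed

lemma primary_T09:
  "primary_degeneration T09 \<nu> \<longleftrightarrow> \<nu> \<cong>\<^sub>a T07 0 \<or> \<nu> \<cong>\<^sub>a T08 1"
proof -
  have "primary_degeneration T09 \<nu> \<longleftrightarrow> (\<exists>B\<in>{T07 0, T08 1}. \<nu> \<cong>\<^sub>a B)"
    by (rule primary_degeneration_iff[OF terminal2_T(9), where N = "{T03, zero_alg}"])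
      (use degenerates_T09_cases in \<open>auto simp: degeneration_facts\<close>)
  then show ?thesis by simp
qed

lemma primary_T10:
  "primary_degeneration (T10 \<alpha>) \<nu> \<longleftrightarrow> \<nu> \<cong>\<^sub>a zero_alg"
proof -
  have "primary_degeneration (T10 \<alpha>) \<nu> \<longleftrightarrow> (\<exists>B\<in>{zero_alg}. \<nu> \<cong>\<^sub>a B)"
    by (rule primary_degeneration_iff[OF terminal2_T(10), where N = "{}"])
      (use degenerates_T10_cases in \<open>auto simp: degeneration_facts\<close>)
  then show ?thesis by simp
qed

text \<open>The classification also yields the zero algebra as a possible source, whose orbit is a
  closed point.\<close>

lemma primary_zero_alg:
  "primary_degeneration zero_alg \<nu> \<longleftrightarrow> False"
proof -
  have "primary_degeneration zero_alg \<nu> \<longleftrightarrow> (\<exists>B\<in>{}. \<nu> \<cong>\<^sub>a B)"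
    by (rule primary_degeneration_iff[OF terminal2_T(11), where N = "{}"])
      (use degenerates_zero_alg_cases in \<open>auto simp: degeneration_facts\<close>)
  then show ?thesis by simp
qed

end

theorem theorem15:
  fixes \<mu> \<nu> :: "'k::{alg_closed_field, field_char_0} mult2"
  shows "primary_degeneration \<mu> \<nu> \<longleftrightarrow>
    (\<exists>(A, B) \<in>
        {(T09, T07 0), (T09, T08 1)}
      \<union> {(T01, T03), (T02, T03), (T04, T03), (T05, T03)}
      \<union> {(T07 \<alpha>, T03) | \<alpha>. \<alpha> \<noteq> 1}
      \<union> {(T08 \<alpha>, T03) | \<alpha>. \<alpha> \<noteq> 2 \<and> \<alpha> \<noteq> 3 / 2}
      \<union> {(T01, T10 1), (T02, T10 2)}
      \<union> {(T10 \<alpha>, zero_alg) | \<alpha>. True}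
      \<union> {(T03, zero_alg), (T06, zero_alg)}.
      \<mu> \<cong>\<^sub>a A \<and> \<nu> \<cong>\<^sub>a B)"
    (is "_ \<longleftrightarrow> (\<exists>(A, B) \<in> ?S. _ A B)")
proof -
  note primary = primary_T01 primary_T02 primary_T03 primary_T04 primary_T05 primary_T06
    primary_T07 primary_T08 primary_T09 primary_T10
  define S where "S = ?S"
  have S: "(T01, T03) \<in> S" "(T01, T10 1) \<in> S" "(T02, T03) \<in> S" "(T02, T10 2) \<in> S"
    "(T03, zero_alg) \<in> S" "(T04, T03) \<in> S" "(T05, T03) \<in> S" "(T06, zero_alg) \<in> S"
    "(T09, T07 0) \<in> S" "(T09, T08 1) \<in> S"
    unfolding S_def by simp_all
  have S07: "(T07 \<alpha>, T03) \<in> S" if "\<alpha> \<noteq> 1" for \<alpha> :: 'k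
    unfolding S_def by (rule UnI1, rule UnI1, rule UnI1, rule UnI1, rule UnI2) (use that in blast)
  have S08: "(T08 \<alpha>, T03) \<in> S" if "\<alpha> \<noteq> 2" "\<alpha> \<noteq> 3 / 2" for \<alpha> :: 'k
    unfolding S_def by (rule UnI1, rule UnI1, rule UnI1, rule UnI2) (use that in blast)
  have S10: "(T10 \<alpha>, zero_alg) \<in> S" for \<alpha> :: 'k
    unfolding S_def by (rule UnI1, rule UnI2) blast
  have "\<exists>A B. (A, B) \<in> S \<and> \<mu> \<cong>\<^sub>a A \<and> \<nu> \<cong>\<^sub>a B" if p: "primary_degeneration \<mu> \<nu>"
  proof -
    \<comment> \<open>Primarity is invariant under isomorphism, so \<open>\<mu>\<close> may be
      replaced by its normal form.\<close>
    have q: "primary_degeneration A \<nu>" if "\<mu> \<cong>\<^sub>a A" for A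
      using primary_degeneration_alg_iso[OF p that alg_iso_refl] .
    have "\<mu> \<in> terminal2"
      using p by (simp add: primary_degeneration_def proper_degeneration_def degenerates_def)
    then show ?thesis
    proof (cases rule: normal_form_cases)
      case T01
      then show ?thesis using q[OF T01] S(1,2) primary_T01[of \<nu>] by blast
    next
      case T02
      then show ?thesis using q[OF T02] S(3,4) primary_T02[of \<nu>] by blast
    next
      case T03
      then show ?thesis using q[OF T03] S(5) primary_T03[of \<nu>] by blast
    next
      case T04
      then show ?thesis using q[OF T04] S(6) primary_T04[of \<nu>] by blast
    next
      case T05
      then show ?thesis using q[OF T05] S(7) primary_T05[of \<nu>] by blast
    next
      case T06
      then show ?thesis using q[OF T06] S(8) primary_T06[of \<nu>] by blast
    next
      case T09
      then show ?thesis using q[OF T09] S(9,10) primary_T09[of \<nu>] by blast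
    next
      case (T07 \<alpha>)
      then show ?thesis using q[OF T07(2)] S07[OF T07(1)] primary_T07[OF T07(1)] by blast
    next
      case (T08 \<alpha>)
      then show ?thesis using q[OF T08(3)] S08[OF T08(1,2)] primary_T08[OF T08(1,2)] by blast
    next
      case (T10 \<alpha>)
      then show ?thesis using q[OF T10] S10[of \<alpha>] primary_T10 by blast
    next
      case zero
      then show ?thesis using q[OF zero] primary_zero_alg by blast
    qed
  qed
  moreover have "primary_degeneration A B" if "(A, B) \<in> S" for A B
    using that unfolding S_def
    by (elim UnE insertE emptyE CollectE exE conjE)
      (simp_all only: prod.inject, simp_all add: primary alg_iso_refl)
  then have "primary_degeneration \<mu> \<nu>" if "(A, B) \<in> S" "\<mu> \<cong>\<^sub>a A" "\<nu> \<cong>\<^sub>a B" for A B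
    using primary_degeneration_alg_iso[OF _ alg_iso_sym alg_iso_sym] that by blast
  ultimately have "primary_degeneration \<mu> \<nu> \<longleftrightarrow> (\<exists>(A, B) \<in> S. \<mu> \<cong>\<^sub>a A \<and> \<nu> \<cong>\<^sub>a B)" by blast
  then show ?thesis unfolding S_def .
qed

end
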